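(* Let $\left\{\mathcal{N}^{(i)}_{A \to B }\right\}_{i=1}^s$ be a compound quantum channel and let $\varepsilon, \eta \in (0,1)$. Let $A'\equiv A$ be a purifying register. Then for any $R$ satisfying \begin{equation*} R \leq \min_{i \in [1:s]} \left(\max _{|\psi\rangle\langle\psi|_{A A'}} \hat{\mathrm{I}}^{\varepsilon}_{\mathrm{H}}(B:A')_{\mathcal{N}^{(i)}_{A \to B } (|\psi\rangle\langle\psi|_{AA'})} + (\log2s)\log \left(\frac{\eta}{6\log(2s)}\right) + \log\frac{\varepsilon}{4s^2}\right), \end{equation*} there exists an $(R, \varepsilon+3\eta)$-entanglement assisted code for compound channel $\left\{\mathcal{N}^{(i)}_{A \to B }\right\}_{i=1}^s$ in the case of informed sender.
   Context: For quantum states $\rho,\sigma$, $\mathrm{D}^{\varepsilon}_{\mathrm{H}}(\rho\|\sigma) := \max_{0\preceq M\preceq \mathbb{I},\ \mathrm{Tr}[M\rho]\geq 1-\varepsilon} -\log\mathrm{Tr}[M\sigma]$. For a bipartite state $\rho_{BA'}$, $\hat{\mathrm{I}}^{\varepsilon}_{\mathrm{H}}(B:A')_{\rho} := \min_{\tau_B,\sigma_{A'}} \mathrm{D}^{\varepsilon}_{\mathrm{H}}(\rho_{BA'}\|\tau_B\otimes\sigma_{A'})$, minimizing over all quantum states $\tau_B,\sigma_{A'}$. An $(R,\varepsilon)$-entanglement assisted code for the compound channel $\{\mathcal{N}^{(i)}_{A\to B}\}_{i=1}^s$ in the case of informed sender consists of a shared entangled state $|\theta\rangle_{E_AE_B}$,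 encoding operations $\mathcal{E}_i: ME_A\to A$ for Alice that may depend on the index $i$ of the channel in use (Alice knows $i$, Bob does not), messages in $[1:2^R]$, and a single decoding operation $\mathcal{D}: BE_B\to M'$ for Bob, such that for all messages $m$ and all $i\in[1:s]$, $\Pr\{M'\neq m\mid M=m\}\leq\varepsilon$. *)

theory Defs
  imports "Jordan_Normal_Form.Matrix" "HOL-Library.Extended_Real"
begin

text \<open>Finite-dimensional quantum systems: a system of dimension n is represented by
complex n x n matrices (Jordan_Normal_Form mat).  Bipartite systems X Y use the
Kronecker ordering: basis index (x,y) is x * dim Y + y.\<close>

definition mtrace :: "complex mat \<Rightarrow> complex" where
  "mtrace A = (\<Sum>i<dim_row A. A $$ (i, i))"

definition adj :: "complex mat \<Rightarrow> complex mat" where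
  "adj A = mat (dim_col A) (dim_row A) (\<lambda>(i, j). cnj (A $$ (j, i)))"

definition msum :: "nat \<Rightarrow> ('b \<Rightarrow> complex mat) \<Rightarrow> 'b list \<Rightarrow> complex mat" where
  "msum n f xs = foldr (\<lambda>x acc. f x + acc) xs (0\<^sub>m n n)"

definition psd :: "nat \<Rightarrow> complex mat \<Rightarrow> bool" where
  "psd n A \<longleftrightarrow> A \<in> carrier_mat n n \<and>
     (\<forall>v \<in> carrier_vec n. let z = (\<Sum>i<n. cnj (v $ i) * (A *\<^sub>v v) $ i) in Im z = 0 \<and> Re z \<ge> 0)"

definition density :: "nat \<Rightarrow> complex mat \<Rightarrow> bool" where
  "density n \<rho> \<longleftrightarrow> psd n \<rho> \<and> mtrace \<rho> = 1"

definition effect :: "nat \<Rightarrow> complex mat \<Rightarrow> bool" where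
  "effect n M \<longleftrightarrow> psd n M \<and> psd n (1\<^sub>m n - M)"

definition unit_state :: "nat \<Rightarrow> complex vec \<Rightarrow> bool" where
  "unit_state n v \<longleftrightarrow> v \<in> carrier_vec n \<and> (\<Sum>i<n. (cmod (v $ i))\<^sup>2) = 1"

definition proj :: "complex vec \<Rightarrow> complex mat" where
  "proj v = mat (dim_vec v) (dim_vec v) (\<lambda>(i, j). v $ i * cnj (v $ j))"

definition kron :: "complex mat \<Rightarrow> complex mat \<Rightarrow> complex mat" where
  "kron A B = mat (dim_row A * dim_row B) (dim_col A * dim_col B)
     (\<lambda>(i, j). A $$ (i div dim_row B, j div dim_col B) * B $$ (i mod dim_row B, j mod dim_col B))"

definition channel :: "nat \<Rightarrow> nat \<Rightarrow> (complex mat \<Rightarrow> complex mat) \<Rightarrow> bool" where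
  "channel dIn dOut N \<longleftrightarrow> (\<exists>Ks :: complex mat list.
     set Ks \<subseteq> carrier_mat dOut dIn \<and>
     msum dIn (\<lambda>K. adj K * K) Ks = 1\<^sub>m dIn \<and>
     (\<forall>X \<in> carrier_mat dIn dIn. N X = msum dOut (\<lambda>K. K * X * adj K) Ks))"

text \<open>(N \<otimes> id_R)(\<rho>) for \<rho> on X R (dim X = dIn, dim R = d), output on Y R (dim Y = dOut).
Uses linearity: \<rho> = \<Sum> \<rho>_{rr'} \<otimes> |r><r'|.\<close>
definition tensor_id :: "(complex mat \<Rightarrow> complex mat) \<Rightarrow> nat \<Rightarrow> nat \<Rightarrow> nat \<Rightarrow> complex mat \<Rightarrow> complex mat" where
  "tensor_id N dIn dOut d \<rho> = mat (dOut * d) (dOut * d) (\<lambda>(r, c).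
     N (mat dIn dIn (\<lambda>(a, b). \<rho> $$ (a * d + r mod d, b * d + c mod d))) $$ (r div d, c div d))"

definition neglog2 :: "real \<Rightarrow> ereal" where
  "neglog2 x = (if x \<le> 0 then \<infinity> else ereal (- log 2 x))"

definition DH :: "real \<Rightarrow> nat \<Rightarrow> complex mat \<Rightarrow> complex mat \<Rightarrow> ereal" where
  "DH eps n \<rho> \<sigma> = Sup {neglog2 (Re (mtrace (M * \<sigma>))) | M.
       effect n M \<and> Re (mtrace (M * \<rho>)) \<ge> 1 - eps}"

definition IH :: "real \<Rightarrow> nat \<Rightarrow> nat \<Rightarrow> complex mat \<Rightarrow> ereal" where
  "IH eps dB dA' \<rho> = Inf {DH eps (dB * dA') \<rho> (kron \<tau> \<sigma>) | \<tau> \<sigma>.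
       density dB \<tau> \<and> density dA' \<sigma>}"

text \<open>(R, eps) entanglement-assisted code for the compound channel {N i | i \<in> {1..s}}
(channels from dim dA to dim dB), informed sender.  Messages are {0..<nat \<lceil>2 powr R\<rceil>}.
Shared pure state \<theta> on E_A E_B; encoders Enc i m : E_A \<rightarrow> A (depending on channel index i
and message m); decoder POVM {D m'} on B E_B.\<close>
definition EA_code_informed ::
  "nat \<Rightarrow> nat \<Rightarrow> nat \<Rightarrow> (nat \<Rightarrow> complex mat \<Rightarrow> complex mat) \<Rightarrow> real \<Rightarrow> real \<Rightarrow> bool" where
  "EA_code_informed s dA dB N R eps \<longleftrightarrow>
    (let Mn = nat \<lceil>2 powr R\<rceil> in
     \<exists>(dEA::nat) (dEB::nat) (\<theta>::complex vec)
       (Enc :: nat \<Rightarrow> nat \<Rightarrow> complex mat \<Rightarrow> complex mat) (D :: nat \<Rightarrow> complex mat).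
       0 < dEA \<and> 0 < dEB \<and> unit_state (dEA * dEB) \<theta> \<and>
       (\<forall>i \<in> {1..s}. \<forall>m < Mn. channel dEA dA (Enc i m)) \<and>
       (\<forall>m' < Mn. psd (dB * dEB) (D m')) \<and>
       msum (dB * dEB) D [0..<Mn] = 1\<^sub>m (dB * dEB) \<and>
       (\<forall>i \<in> {1..s}. \<forall>m < Mn.
          1 - Re (mtrace (D m * tensor_id (N i) dA dB dEB
                                   (tensor_id (Enc i m) dEA dA dEB (proj \<theta>)))) \<le> eps))"

end

theory Submission
  imports Defs "Jordan_Normal_Form.Spectral_Radius"
begin

text \<open>
  Position-based coding.  Alice and Bob share one copy of the input \<open>\<psi>\<^sub>i\<close> for every pair \<open>(i, m)\<close> of a
  channel index and a message; to send \<open>m\<close> over channel \<open>i\<close>, Alice inputs her half of copy \<open>(i, m)\<close>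
  and discards the others.  Bob's part of copy \<open>x\<close> is then correlated with the channel output for
  \<open>x = (i, m)\<close> only; for any other \<open>x\<close> the two are in a product state.  Let \<open>\<tau>\<close> be the average over
  \<open>j\<close> of the output marginals of the states \<open>\<N>\<^sub>j(\<psi>\<^sub>j)\<close> and \<open>\<sigma>\<^sub>i\<close> the reference marginal of \<open>\<psi>\<^sub>i\<close>.  The
  definition of the mutual information gives tests \<open>\<Lambda>\<^sub>i\<close> accepting \<open>\<N>\<^sub>i(\<psi>\<^sub>i)\<close> with probability at least
  \<open>1 - \<epsilon>\<close> and \<open>\<tau> \<otimes> \<sigma>\<^sub>i\<close> with probability of order \<open>2\<^bsup>-R\<^esup>\<epsilon>\<eta>/s\<^sup>2\<close>.

  Bob decodes with the pretty good measurement \<open>D\<^sub>x = C\<^bsup>-1/2\<^esup> A\<^sub>x C\<^bsup>-1/2\<^esup>\<close>, \<open>C = \<Sum>\<^sub>x A\<^sub>x\<close>, of the received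
  states \<open>A\<^sub>x\<close>.  For every effect \<open>T\<close> it satisfies \<open>2 Tr(A\<^sub>x T) \<le> Tr(A\<^sub>x D\<^sub>x) + Tr(C T)\<close>: in an
  eigenbasis of \<open>C\<close> with eigenvalues \<open>c\<^sub>k\<close> and \<open>w = \<surd>(c\<^sub>k c\<^sub>l)\<close>, add up the inequalities
  \<open>2 Re(A\<^sub>k\<^sub>l T\<^sub>l\<^sub>k) \<le> |A\<^sub>k\<^sub>l|\<^sup>2/w + w|T\<^sub>k\<^sub>l|\<^sup>2\<close> and use \<open>w \<le> (c\<^sub>k + c\<^sub>l)/2\<close> and \<open>T\<^sup>2 \<le> T\<close>.  With \<open>T = \<Lambda>\<^sub>i\<close>
  acting on the output and copy \<open>x\<close>, the error is at most \<open>\<epsilon>\<close> plus the total acceptance probability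
  of the wrong positions, which is at most \<open>\<eta>\<close>.
\<close>


section \<open>Matrix entries, adjoints and real diagonal matrices\<close>

lemma mult_mat_entry:
  assumes "A \<in> carrier_mat n m" "B \<in> carrier_mat m k" "i < n" "j < k"
  shows "(A * B) $$ (i, j) = (\<Sum>l<m. A $$ (i, l) * B $$ (l, j))"
  using assms by (auto simp: scalar_prod_def atLeast0LessThan intro!: sum.cong)

lemma mult_mat_vec_entry:
  assumes "A \<in> carrier_mat n m" "v \<in> carrier_vec m" "i < n"
  shows "(A *\<^sub>v v) $ i = (\<Sum>l<m. A $$ (i, l) * v $ l)"
  using assms by (auto simp: scalar_prod_def atLeast0LessThan intro!: sum.cong)

lemma adj_carrier [simp]: "A \<in> carrier_mat n m \<Longrightarrow> adj A \<in> carrier_mat m n"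
  by (auto simp: adj_def)

lemma adj_dim [simp]: "dim_row (adj A) = dim_col A" "dim_col (adj A) = dim_row A"
  by (auto simp: adj_def)

lemma adj_entry: "A \<in> carrier_mat n m \<Longrightarrow> i < m \<Longrightarrow> j < n \<Longrightarrow> adj A $$ (i, j) = cnj (A $$ (j, i))"
  by (auto simp: adj_def)

lemma adj_adj [simp]: "adj (adj A) = A"
  by (rule eq_matI) (auto simp: adj_def)

lemma adj_mult:
  assumes A: "A \<in> carrier_mat n m" and B: "B \<in> carrier_mat m k"
  shows "adj (A * B) = adj B * adj A"
proof (rule eq_matI)
  fix i j assume "i < dim_row (adj B * adj A)" "j < dim_col (adj B * adj A)"
  with A B have i: "i < k" and j: "j < n" by (auto simp: adj_def)
  show "adj (A * B) $$ (i, j) = (adj B * adj A) $$ (i, j)"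
    using mult_mat_entry[OF A B j i] i j A B
    by (simp add: adj_entry[of _ n k] mult_mat_entry[of _ k m _ n] adj_entry[OF A] adj_entry[OF B] mult.commute
        del: index_mult_mat(1))
qed (use A B in \<open>auto simp: adj_def\<close>)

lemma hermitianI:
  assumes "A \<in> carrier_mat n n" "\<And>i j. i < n \<Longrightarrow> j < n \<Longrightarrow> A $$ (i, j) = cnj (A $$ (j, i))"
  shows "adj A = A"
proof (rule eq_matI)
  fix i j assume "i < dim_row A" "j < dim_col A"
  then have ij: "i < n" "j < n" using assms(1) by auto
  show "adj A $$ (i, j) = A $$ (i, j)"
    unfolding adj_entry[OF assms(1) ij] using assms(2)[OF ij] by (rule sym)
qed (use assms(1) in \<open>auto simp: adj_def\<close>)

lemma hermitianD:
  assumes "adj A = A" "A \<in> carrier_mat n n" "i < n" "j < n"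
  shows "cnj (A $$ (i, j)) = A $$ (j, i)"
  using assms adj_entry[of A n n j i] by simp

definition real_diag :: "nat \<Rightarrow> (nat \<Rightarrow> real) \<Rightarrow> complex mat" where
  "real_diag n c = mat n n (\<lambda>(i, j). if i = j then of_real (c i) else 0)"

lemma real_diag_carrier [simp]: "real_diag n c \<in> carrier_mat n n"
  by (simp add: real_diag_def)

lemma adj_real_diag [simp]: "adj (real_diag n c) = real_diag n c"
  by (rule hermitianI) (auto simp: real_diag_def)

lemma real_diag_mult_left:
  assumes "A \<in> carrier_mat n m" "i < n" "j < m"
  shows "(real_diag n c * A) $$ (i, j) = of_real (c i) * A $$ (i, j)"
proof -
  have "(real_diag n c * A) $$ (i, j) = (\<Sum>l<n. (if i = l then of_real (c i) * A $$ (l, j) else 0))"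
    unfolding mult_mat_entry[OF real_diag_carrier assms]
    by (rule sum.cong) (use assms in \<open>auto simp: real_diag_def\<close>)
  then show ?thesis using assms by (simp del: index_mult_mat)
qed

lemma real_diag_mult_right:
  assumes "A \<in> carrier_mat n m" "i < n" "j < m"
  shows "(A * real_diag m c) $$ (i, j) = A $$ (i, j) * of_real (c j)"
proof -
  have "(A * real_diag m c) $$ (i, j) = (\<Sum>l<m. (if l = j then A $$ (i, l) * of_real (c j) else 0))"
    unfolding mult_mat_entry[OF assms(1) real_diag_carrier assms(2,3)]
    by (rule sum.cong) (use assms in \<open>auto simp: real_diag_def\<close>)
  then show ?thesis using assms by (simp del: index_mult_mat)
qed

lemma real_diag_mult: "real_diag n c * real_diag n d = real_diag n (\<lambda>i. c i * d i)"
proof (rule eq_matI)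
  fix i j assume "i < dim_row (real_diag n (\<lambda>i. c i * d i))" "j < dim_col (real_diag n (\<lambda>i. c i * d i))"
  then have "i < n" "j < n" by (auto simp: real_diag_def)
  then show "(real_diag n c * real_diag n d) $$ (i, j) = real_diag n (\<lambda>i. c i * d i) $$ (i, j)"
    by (subst real_diag_mult_left[of _ n n]) (auto simp: real_diag_def)
qed (auto simp: real_diag_def)

section \<open>Spectral theorem for Hermitian matrices\<close>

text \<open>Householder reflection: for a unit vector \<open>x\<close> whose inner product
  \<open>r\<close> with the first basis vector \<open>e0\<close> is real, the reflection along
  \<open>w = x - e0\<close> exchanges \<open>e0\<close> and \<open>x\<close>. Since \<open>w\<close>
  has squared norm \<open>2 - 2 * r\<close>, the reflection is the identity minus
  \<open>w w^H / (1 - r)\<close>.\<close>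

lemma exists_reflection_with_column:
  fixes v :: "complex vec"
  assumes v: "v \<in> carrier_vec n" and v0: "v \<noteq> 0\<^sub>v n" and n: "0 < n"
  obtains H a where "H \<in> carrier_mat n n" "adj H = H" "H * H = 1\<^sub>m n"
    "\<And>i. i < n \<Longrightarrow> H $$ (i, 0) = a * v $ i"
proof -
  define N where "N = sqrt (\<Sum>i<n. (cmod (v $ i))\<^sup>2)"
  obtain k where k: "k < n" "v $ k \<noteq> 0"
    using v v0 by (metis carrier_vecD eq_vecI index_zero_vec(1) index_zero_vec(2))
  have "0 < (cmod (v $ k))\<^sup>2" using k by simp
  also have "\<dots> \<le> (\<Sum>i<n. (cmod (v $ i))\<^sup>2)"
    by (rule member_le_sum) (use k in auto)
  finally have Npos: "N > 0" by (simp add: N_def)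
  have N2: "N\<^sup>2 = (\<Sum>i<n. (cmod (v $ i))\<^sup>2)" by (simp add: N_def sum_nonneg)
  \<comment> \<open>Besides normalising \<open>v\<close>, the scalar \<open>a\<close> rotates the
    first coordinate to a real number that is at most 0. The inner product with \<open>e0\<close> is
    thus real, and \<open>1 - r\<close> is at least 1 even when \<open>v\<close> is a multiple of
    \<open>e0\<close>.\<close>
  define a where "a = (if v $ 0 = 0 then 1 / of_real N else - cnj (v $ 0) / of_real (cmod (v $ 0) * N))"
  define r where "r = - cmod (v $ 0) / N"
  define x where "x i = a * v $ i" for i
  have x0: "x 0 = of_real r"
  proof (cases "v $ 0 = 0")
    case False
    have "cnj (v $ 0) * v $ 0 = (of_real (cmod (v $ 0)))\<^sup>2"
      using complex_norm_square[of "v $ 0"] by (simp add: mult.commute)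
    then show ?thesis using False Npos by (simp add: x_def a_def r_def field_simps power2_eq_square)
  qed (simp add: x_def r_def)
  have r: "r \<le> 0" using Npos by (simp add: r_def divide_nonneg_pos)
  have na: "cmod a = 1 / N" using Npos by (auto simp: a_def norm_divide norm_mult)
  have x1: "(\<Sum>i<n. (cmod (x i))\<^sup>2) = 1"
  proof -
    have "(\<Sum>i<n. (cmod (x i))\<^sup>2) = (\<Sum>i<n. (1 / N)\<^sup>2 * (cmod (v $ i))\<^sup>2)"
      by (simp add: x_def norm_mult na power_divide)
    also have "\<dots> = (1 / N)\<^sup>2 * N\<^sup>2" by (simp only: N2 sum_distrib_left)
    finally show ?thesis using Npos by (simp add: power_divide)
  qed
  define w where "w i = x i - (if i = 0 then 1 else 0)" for i :: nat
  have "(\<Sum>i<n. (cmod (w i))\<^sup>2) = (\<Sum>i<n. (cmod (x i))\<^sup>2 + (if i = 0 then 1 - 2 * r else 0))"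
  proof (rule sum.cong)
    fix i show "(cmod (w i))\<^sup>2 = (cmod (x i))\<^sup>2 + (if i = 0 then 1 - 2 * r else 0)"
    proof (cases "i = 0")
      case True
      have "w 0 = of_real (r - 1)" by (simp add: w_def x0)
      then have "(cmod (w 0))\<^sup>2 = (r - 1)\<^sup>2" by (simp only: norm_of_real) simp
      then show ?thesis using True by (simp add: x0 power2_eq_square algebra_simps)
    qed (simp add: w_def)
  qed simp
  also have "\<dots> = 2 - 2 * r" using n x1 by (simp add: sum.distrib)
  finally have "complex_of_real (\<Sum>i<n. (cmod (w i))\<^sup>2) = of_real (2 - 2 * r)" by simp
  then have w2: "(\<Sum>i<n. cnj (w i) * w i) = of_real (2 - 2 * r)"
    by (simp add: complex_norm_square mult.commute flip: of_real_power)
  define H where "H = mat n n (\<lambda>(i, j). (if i = j then 1 else 0) - w i * cnj (w j) / of_real (1 - r))"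
  have Hc: "H \<in> carrier_mat n n" by (simp add: H_def)
  show ?thesis
  proof (rule that[OF Hc])
    show "adj H = H" by (rule hermitianI[OF Hc]) (auto simp: H_def)
    have rr: "complex_of_real (1 - r) \<noteq> 0"
      using r by (simp only: of_real_eq_0_iff)
    have cancel: "x / y\<^sup>2 * (2 * y) = 2 * (x / y)" if "y \<noteq> 0" for x y :: complex
      using that by (simp add: field_simps power2_eq_square)
    have neg_cancel: "x * - y / y = - x" if "y \<noteq> 0" for x y :: complex
      using that by simp
    show "H * H = 1\<^sub>m n"
    proof (rule eq_matI)
      fix i j assume "i < dim_row (1\<^sub>m n :: complex mat)" "j < dim_col (1\<^sub>m n :: complex mat)"
      then have ij: "i < n" "j < n" by auto
      let ?R = "complex_of_real (1 - r)"
      have "(H * H) $$ (i, j) = (\<Sum>l<n. H $$ (i, l) * H $$ (l, j))"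
        by (rule mult_mat_entry[OF Hc Hc ij])
      \<comment> \<open>Two cross terms and one term quadratic in \<open>w w^H\<close>; by the
        squared norm of \<open>w\<close> the quadratic term cancels both cross terms.\<close>
      also have "\<dots> = (\<Sum>l<n. (if i = l then (if i = j then 1 else 0) - w i * cnj (w j) / ?R else 0)
          - (if l = j then w i * cnj (w j) / ?R else 0)
          + w i * cnj (w j) / ?R\<^sup>2 * (cnj (w l) * w l))"
        by (rule sum.cong) (use ij in \<open>auto simp: H_def algebra_simps power2_eq_square\<close>)
      also have "\<dots> = ((if i = j then 1 else 0) - w i * cnj (w j) / ?R) - w i * cnj (w j) / ?R
          + w i * cnj (w j) / ?R\<^sup>2 * (of_real (2 - 2 * r))"
        unfolding sum.distrib sum_subtractf sum_distrib_left[symmetric] w2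
        using ij by simp
      also have "complex_of_real (2 - 2 * r) = 2 * ?R" by simp
      also have "w i * cnj (w j) / ?R\<^sup>2 * (2 * ?R) = 2 * (w i * cnj (w j) / ?R)"
        using cancel[OF rr] .
      finally show "(H * H) $$ (i, j) = 1\<^sub>m n $$ (i, j)" using ij by simp
    qed (auto simp: H_def)
    fix i assume i: "i < n"
    have "w 0 = - of_real (1 - r)" by (simp add: w_def x0)
    then have "w i * cnj (w 0) / of_real (1 - r) = - w i"
      using neg_cancel[OF rr] by (simp only: complex_cnj_minus complex_cnj_complex_of_real)
    then show "H $$ (i, 0) = a * v $ i" using i n by (simp add: H_def w_def x_def)
  qed
qed

text \<open>The block diagonal matrix with the one-by-one block \<open>z\<close> and the block
  \<open>M\<close>.\<close>

definition border :: "nat \<Rightarrow> complex \<Rightarrow> complex mat \<Rightarrow> complex mat" where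
  "border n z M = mat (Suc n) (Suc n)
     (\<lambda>(i, j). if i = 0 \<and> j = 0 then z else if i = 0 \<or> j = 0 then 0 else M $$ (i - 1, j - 1))"

lemma border_carrier [simp]: "border n z M \<in> carrier_mat (Suc n) (Suc n)"
  by (simp add: border_def)

lemma border_mult:
  assumes "M \<in> carrier_mat n n" "L \<in> carrier_mat n n"
  shows "border n z M * border n w L = border n (z * w) (M * L)"
proof (rule eq_matI)
  fix i j assume "i < dim_row (border n (z * w) (M * L))" "j < dim_col (border n (z * w) (M * L))"
  then have ij: "i < Suc n" "j < Suc n" by (auto simp: border_def)
  show "(border n z M * border n w L) $$ (i, j) = border n (z * w) (M * L) $$ (i, j)"
    unfolding mult_mat_entry[OF border_carrier border_carrier ij] sum.lessThan_Suc_shift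
    using ij assms by (cases i; cases j) (auto simp: border_def mult_mat_entry[of _ n n _ n] simp del: index_mult_mat(1))
qed (auto simp: border_def)

lemma border_adj: "M \<in> carrier_mat n n \<Longrightarrow> adj (border n z M) = border n (cnj z) (adj M)"
  by (rule eq_matI) (auto simp: border_def adj_def)

lemma border_one: "border n 1 (1\<^sub>m n) = 1\<^sub>m (Suc n)"
  by (rule eq_matI) (auto simp: border_def)

lemma border_real_diag: "border n (of_real x) (real_diag n c) = real_diag (Suc n) (case_nat x c)"
  by (rule eq_matI) (auto simp: border_def real_diag_def split: nat.splits)

text \<open>Deflation by induction on the dimension: conjugating with a reflection whose first
  column is an eigenvector splits off a one-by-one block, and the induction hypothesis diagonalises
  the rest.\<close>

theorem hermitian_diagonalization:
  assumes "A \<in> carrier_mat n n" "adj A = A"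
  shows "\<exists>U c. U \<in> carrier_mat n n \<and> adj U * U = 1\<^sub>m n \<and> U * adj U = 1\<^sub>m n
    \<and> A = U * real_diag n c * adj U"
  using assms
proof (induction n arbitrary: A)
  case 0
  then show ?case by (intro exI[of _ "1\<^sub>m 0"]) (auto intro!: eq_matI)
next
  case (Suc n)
  let ?n = "Suc n"
  note A = Suc.prems(1) and hA = Suc.prems(2)
  obtain l v where ev: "eigenvector A v l"
    using spectrum_non_empty[OF A] by (auto simp: spectrum_def eigenvalue_def)
  then have v: "v \<in> carrier_vec ?n" "v \<noteq> 0\<^sub>v ?n" and Av: "A *\<^sub>v v = l \<cdot>\<^sub>v v"
    using A by (auto simp: eigenvector_def)
  obtain H a where H: "H \<in> carrier_mat ?n ?n" and hH: "adj H = H" and HH: "H * H = 1\<^sub>m ?n"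
    and H0: "\<And>i. i < ?n \<Longrightarrow> H $$ (i, 0) = a * v $ i"
    using exists_reflection_with_column[OF v] by blast
  have AH: "A * H \<in> carrier_mat ?n ?n" using A H by simp
  define B where "B = H * (A * H)"
  have B: "B \<in> carrier_mat ?n ?n" using AH H by (simp add: B_def)
  have hB: "adj B = B"
    unfolding B_def adj_mult[OF H AH] adj_mult[OF A H] hA hH using A H by (simp add: assoc_mult_mat[of _ ?n ?n _ ?n _ ?n])
  have AH0: "(A * H) $$ (i, 0) = l * H $$ (i, 0)" if "i < ?n" for i
  proof -
    have "(A * H) $$ (i, 0) = a * (\<Sum>k<?n. A $$ (i, k) * v $ k)"
      unfolding mult_mat_entry[OF A H that zero_less_Suc] sum_distrib_left
      by (rule sum.cong) (auto simp: H0)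
    also have "\<dots> = a * (A *\<^sub>v v) $ i" using mult_mat_vec_entry[OF A v(1) that] by simp
    finally show ?thesis using that v H0 by (simp add: Av)
  qed
  \<comment> \<open>The first column of \<open>A * H\<close> is \<open>l\<close> times that of
    \<open>H\<close>, so \<open>H * H = 1\<close> turns the first column of \<open>B\<close> into
    \<open>l\<close> times the first basis vector. The first row follows by Hermiticity.\<close>
  have B0: "B $$ (i, 0) = (if i = 0 then l else 0)" if i: "i < ?n" for i
  proof -
    have "B $$ (i, 0) = (\<Sum>k<?n. H $$ (i, k) * (l * H $$ (k, 0)))"
      unfolding B_def mult_mat_entry[OF H AH i zero_less_Suc]
      by (rule sum.cong) (auto simp: AH0)
    also have "\<dots> = l * (H * H) $$ (i, 0)"
      unfolding mult_mat_entry[OF H H i zero_less_Suc] sum_distrib_left by (simp add: mult_ac)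
    finally show ?thesis using i by (simp add: HH)
  qed
  have B0': "B $$ (0, j) = (if j = 0 then cnj l else 0)" if "j < ?n" for j
    using hermitianD[OF hB B that, of 0] B0[OF that] by auto
  \<comment> \<open>The corner entry belongs to both the first column and the first row; comparing
    the two values shows that the eigenvalue is real.\<close>
  have "cnj l = l" using B0[of 0] B0'[of 0] by simp
  then obtain x where x: "l = of_real x" by (metis Reals_cases Reals_cnj_iff)
  define C where "C = mat n n (\<lambda>(i, j). B $$ (Suc i, Suc j))"
  have C: "C \<in> carrier_mat n n" by (simp add: C_def)
  have "adj C = C" by (rule hermitianI[OF C]) (auto simp: C_def hermitianD[OF hB B])
  from Suc.IH[OF C this] obtain U c where U: "U \<in> carrier_mat n n" "adj U * U = 1\<^sub>m n" "U * adj U = 1\<^sub>m n"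
    and CU: "C = U * real_diag n c * adj U" by blast
  have "B = border n l C"
    by (rule eq_matI) (use B B0 B0' x in \<open>auto simp: border_def C_def\<close>)
  also have "\<dots> = border n 1 U * real_diag ?n (case_nat x c) * adj (border n 1 U)"
    using U by (simp add: CU border_adj border_mult x flip: border_real_diag)
  finally have B': "B = border n 1 U * real_diag ?n (case_nat x c) * adj (border n 1 U)" .
  define V where "V = H * border n 1 U"
  have V: "V \<in> carrier_mat ?n ?n" using H unfolding V_def by (meson border_carrier mult_carrier_mat)
  have aV: "adj V = adj (border n 1 U) * H"
    unfolding V_def by (subst adj_mult[OF H border_carrier]) (simp add: hH)
  note assoc = assoc_mult_mat[of _ ?n ?n _ ?n _ ?n]
  have bU: "adj (border n 1 U) * border n 1 U = 1\<^sub>m ?n" "border n 1 U * adj (border n 1 U) = 1\<^sub>m ?n"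
    using U by (auto simp: border_adj border_mult border_one)
  have b: "border n 1 U \<in> carrier_mat ?n ?n" "adj (border n 1 U) \<in> carrier_mat ?n ?n" by auto
  have "adj V * V = adj (border n 1 U) * (H * H) * border n 1 U"
    unfolding aV unfolding V_def using H b by (simp add: assoc mult_carrier_mat[of _ ?n ?n _ ?n])
  also have "\<dots> = 1\<^sub>m ?n" using b by (simp only: HH bU right_mult_one_mat)
  finally have 1: "adj V * V = 1\<^sub>m ?n" .
  have "V * adj V = H * (border n 1 U * adj (border n 1 U)) * H"
    unfolding aV unfolding V_def using H b by (simp add: assoc mult_carrier_mat[of _ ?n ?n _ ?n])
  then have 2: "V * adj V = 1\<^sub>m ?n" using H by (simp add: HH bU)
  have "A = (H * H) * A * (H * H)" using A by (simp add: HH)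
  also have "\<dots> = H * B * H" unfolding B_def using A H by (simp add: assoc mult_carrier_mat[of _ ?n ?n _ ?n])
  also have "\<dots> = V * real_diag ?n (case_nat x c) * adj V"
    unfolding B' V_def aV[unfolded V_def] using H b by (simp add: assoc mult_carrier_mat[of _ ?n ?n _ ?n])
  finally show ?case using V 1 2 by blast
qed


section \<open>Traces and positive semidefinite matrices\<close>

lemma mtrace_mult:
  assumes "A \<in> carrier_mat n m" "B \<in> carrier_mat m n"
  shows "mtrace (A * B) = (\<Sum>i<n. \<Sum>j<m. A $$ (i, j) * B $$ (j, i))"
  using assms by (simp add: mtrace_def mult_mat_entry[of _ n m _ n] del: index_mult_mat(1))

lemma mtrace_comm:
  assumes "A \<in> carrier_mat n m" "B \<in> carrier_mat m n"
  shows "mtrace (A * B) = mtrace (B * A)"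
  unfolding mtrace_mult[OF assms] mtrace_mult[OF assms(2,1)]
  by (subst sum.swap) (simp add: mult.commute)

lemma mtrace_add:
  "A \<in> carrier_mat n n \<Longrightarrow> B \<in> carrier_mat n n \<Longrightarrow> mtrace (A + B) = mtrace A + mtrace B"
  by (auto simp: mtrace_def sum.distrib)

lemma mtrace_minus:
  "A \<in> carrier_mat n n \<Longrightarrow> B \<in> carrier_mat n n \<Longrightarrow> mtrace (A - B) = mtrace A - mtrace B"
  by (auto simp: mtrace_def sum_subtractf)

lemma mtrace_smult: "A \<in> carrier_mat n n \<Longrightarrow> mtrace (a \<cdot>\<^sub>m A) = a * mtrace A"
  by (auto simp: mtrace_def sum_distrib_left)

lemma mtrace_one: "mtrace (1\<^sub>m n) = of_nat n"
  by (simp add: mtrace_def)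

text \<open>Vectors are plain functions whose values from \<open>n\<close> on do not matter, so test
  vectors given by formulas carry no dimension conditions.\<close>

definition quad_form :: "nat \<Rightarrow> complex mat \<Rightarrow> (nat \<Rightarrow> complex) \<Rightarrow> complex" where
  "quad_form n A v = (\<Sum>i<n. \<Sum>j<n. cnj (v i) * A $$ (i, j) * v j)"

lemma psd_iff_quad_form:
  "psd n A \<longleftrightarrow> A \<in> carrier_mat n n \<and> (\<forall>v. Im (quad_form n A v) = 0 \<and> 0 \<le> Re (quad_form n A v))"
proof (cases "A \<in> carrier_mat n n")
  case True
  have *: "(\<Sum>i<n. cnj (v $ i) * (A *\<^sub>v v) $ i) = quad_form n A (\<lambda>i. v $ i)" if "v \<in> carrier_vec n" for v
    unfolding quad_form_def
    by (rule sum.cong) (use that in \<open>auto simp: mult_mat_vec_entry[OF True] sum_distrib_left mult_ac\<close>)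
  have **: "quad_form n A v = quad_form n A (\<lambda>i. vec n v $ i)" for v
    unfolding quad_form_def by (auto intro!: sum.cong)
  show ?thesis
    using True * ** by (auto simp: psd_def Let_def) (metis vec_carrier)+
qed (simp add: psd_def)

lemma psd_carrier: "psd n A \<Longrightarrow> A \<in> carrier_mat n n"
  by (simp add: psd_def)

lemma psdD: "psd n A \<Longrightarrow> Im (quad_form n A v) = 0" "psd n A \<Longrightarrow> 0 \<le> Re (quad_form n A v)"
  by (auto simp: psd_iff_quad_form)

lemma psdI:
  assumes "A \<in> carrier_mat n n" "\<And>v. \<exists>r\<ge>0. quad_form n A v = complex_of_real r"
  shows "psd n A"
  unfolding psd_iff_quad_form using assms by (metis Im_complex_of_real Re_complex_of_real)

lemma psd_quad_form_real: "psd n A \<Longrightarrow> \<exists>r\<ge>0. quad_form n A v = complex_of_real r"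
  using psdD[of n A v] by (intro exI[of _ "Re (quad_form n A v)"]) (auto simp: complex_eq_iff)

lemma quad_form_conj:
  assumes P: "P \<in> carrier_mat n n" and K: "K \<in> carrier_mat n m"
  shows "quad_form m (adj K * P * K) v = quad_form n P (\<lambda>i. \<Sum>k<m. K $$ (i, k) * v k)"
proof -
  have aK: "adj K * P \<in> carrier_mat m n" using P K by (meson adj_carrier mult_carrier_mat)
  have "quad_form m (adj K * P * K) v =
     (\<Sum>i<m. \<Sum>j<m. \<Sum>l<n. \<Sum>k<n. cnj (v i) * (cnj (K $$ (k, i)) * P $$ (k, l) * K $$ (l, j)) * v j)"
    unfolding quad_form_def
  proof (intro sum.cong refl)
    fix i j assume "i \<in> {..<m}" "j \<in> {..<m}"
    then have ij: "i < m" "j < m" by auto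
    have "(adj K * P * K) $$ (i, j) = (\<Sum>l<n. \<Sum>k<n. cnj (K $$ (k, i)) * P $$ (k, l) * K $$ (l, j))"
      unfolding mult_mat_entry[OF aK K ij]
      by (rule sum.cong) (use ij in \<open>auto simp: mult_mat_entry[OF adj_carrier[OF K] P] adj_entry[OF K]
          sum_distrib_right simp del: index_mult_mat(1)\<close>)
    then show "cnj (v i) * (adj K * P * K) $$ (i, j) * v j =
      (\<Sum>l<n. \<Sum>k<n. cnj (v i) * (cnj (K $$ (k, i)) * P $$ (k, l) * K $$ (l, j)) * v j)"
      by (simp add: sum_distrib_left sum_distrib_right del: index_mult_mat(1))
  qed
  also have "\<dots> = (\<Sum>l<n. \<Sum>k<n. \<Sum>i<m. \<Sum>j<m. cnj (v i) * (cnj (K $$ (k, i)) * P $$ (k, l) * K $$ (l, j)) * v j)"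
  proof -
    have "(\<Sum>i<m. \<Sum>j<m. \<Sum>l<n. \<Sum>k<n. f i j l k) = (\<Sum>l<n. \<Sum>k<n. \<Sum>i<m. \<Sum>j<m. f i j l k)"
      for f :: "nat \<Rightarrow> nat \<Rightarrow> nat \<Rightarrow> nat \<Rightarrow> complex"
    proof -
      have "(\<Sum>i<m. \<Sum>j<m. \<Sum>l<n. \<Sum>k<n. f i j l k) = (\<Sum>i<m. \<Sum>l<n. \<Sum>j<m. \<Sum>k<n. f i j l k)"
        by (intro sum.cong refl sum.swap)
      also have "\<dots> = (\<Sum>l<n. \<Sum>i<m. \<Sum>j<m. \<Sum>k<n. f i j l k)" by (rule sum.swap)
      also have "\<dots> = (\<Sum>l<n. \<Sum>i<m. \<Sum>k<n. \<Sum>j<m. f i j l k)" by (intro sum.cong refl sum.swap)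
      also have "\<dots> = (\<Sum>l<n. \<Sum>k<n. \<Sum>i<m. \<Sum>j<m. f i j l k)" by (intro sum.cong refl sum.swap)
      finally show ?thesis .
    qed
    then show ?thesis .
  qed
  also have "\<dots> = (\<Sum>k<n. \<Sum>l<n. \<Sum>i<m. \<Sum>j<m. cnj (v i) * (cnj (K $$ (k, i)) * P $$ (k, l) * K $$ (l, j)) * v j)"
    by (rule sum.swap)
  also have "\<dots> = quad_form n P (\<lambda>i. \<Sum>k<m. K $$ (i, k) * v k)"
    unfolding quad_form_def by (intro sum.cong refl) (simp add: sum_distrib_left sum_distrib_right mult_ac)
  finally show ?thesis .
qed

lemma psd_conj:
  assumes "psd n P" "K \<in> carrier_mat n m"
  shows "psd m (adj K * P * K)"
  using assms quad_form_conj[OF psd_carrier[OF assms(1)] assms(2)]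
  by (intro psdI) (auto simp: psd_carrier psd_quad_form_real intro!: mult_carrier_mat[of _ m n] adj_carrier)

lemma quad_form_add:
  "A \<in> carrier_mat n n \<Longrightarrow> B \<in> carrier_mat n n \<Longrightarrow>
    quad_form n (A + B) v = quad_form n A v + quad_form n B v"
  unfolding quad_form_def sum.distrib[symmetric] by (intro sum.cong refl) (auto simp: algebra_simps)

lemma quad_form_smult:
  "A \<in> carrier_mat n n \<Longrightarrow> quad_form n (a \<cdot>\<^sub>m A) v = a * quad_form n A v"
  unfolding quad_form_def sum_distrib_left by (intro sum.cong refl) (auto simp: algebra_simps)

lemma psd_add: "psd n A \<Longrightarrow> psd n B \<Longrightarrow> psd n (A + B)"
  unfolding psd_iff_quad_form by (auto simp: quad_form_add)

lemma psd_smult: "psd n A \<Longrightarrow> 0 \<le> r \<Longrightarrow> psd n (complex_of_real r \<cdot>\<^sub>m A)"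
  unfolding psd_iff_quad_form by (auto simp: quad_form_smult)

lemma psd_zero: "psd n (0\<^sub>m n n)"
  unfolding psd_iff_quad_form by (auto simp: quad_form_def)

lemma psd_one: "psd n (1\<^sub>m n)"
proof (rule psdI)
  fix v
  have "quad_form n (1\<^sub>m n) v = (\<Sum>i<n. \<Sum>j<n. if i = j then cnj (v i) * v i else 0)"
    unfolding quad_form_def by (intro sum.cong refl) auto
  also have "\<dots> = (\<Sum>i<n. of_real ((cmod (v i))\<^sup>2))"
    by (intro sum.cong refl) (auto simp: complex_norm_square mult.commute simp del: of_real_power)
  also have "\<dots> = of_real (\<Sum>i<n. (cmod (v i))\<^sup>2)" by simp
  finally show "\<exists>r\<ge>0. quad_form n (1\<^sub>m n) v = complex_of_real r" by (metis sum_nonneg zero_le_power2)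
qed simp

lemma quad_form_two_point:
  assumes "i < n" "j < n" "i \<noteq> j"
  shows "quad_form n A (\<lambda>k. if k = i then a else if k = j then b else 0) =
    cnj a * A $$ (i, i) * a + cnj a * A $$ (i, j) * b + cnj b * A $$ (j, i) * a + cnj b * A $$ (j, j) * b"
proof -
  let ?v = "\<lambda>k. if k = i then a else if k = j then b else 0"
  have "quad_form n A ?v = (\<Sum>k\<in>{i, j}. \<Sum>l<n. cnj (?v k) * A $$ (k, l) * ?v l)"
    unfolding quad_form_def by (rule sum.mono_neutral_right) (use assms in auto)
  also have "\<dots> = (\<Sum>k\<in>{i, j}. \<Sum>l\<in>{i, j}. cnj (?v k) * A $$ (k, l) * ?v l)"
    by (intro sum.cong refl sum.mono_neutral_right) (use assms in auto)
  finally show ?thesis using assms by auto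
qed

lemma psd_diag:
  assumes "psd n A" "i < n"
  shows "Im (A $$ (i, i)) = 0" "0 \<le> Re (A $$ (i, i))"
proof -
  let ?v = "\<lambda>k. if k = i then 1 else 0"
  have "quad_form n A ?v = (\<Sum>k\<in>{i}. \<Sum>l<n. cnj (?v k) * A $$ (k, l) * ?v l)"
    unfolding quad_form_def by (rule sum.mono_neutral_right) (use assms in auto)
  also have "\<dots> = (\<Sum>k\<in>{i}. \<Sum>l\<in>{i}. cnj (?v k) * A $$ (k, l) * ?v l)"
    by (intro sum.cong refl sum.mono_neutral_right) (use assms in auto)
  finally have "quad_form n A ?v = A $$ (i, i)" by simp
  then show "Im (A $$ (i, i)) = 0" "0 \<le> Re (A $$ (i, i))" using psdD[OF assms(1)] by metis+
qed

text \<open>Polarization: that the form is real at \<open>e_i + e_j\<close> makes the imaginary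
  parts of the two mirrored entries opposite, and at \<open>e_i + \<i> e_j\<close> it makes their
  real parts equal.\<close>

lemma psd_hermitian:
  assumes "psd n A"
  shows "adj A = A"
proof (rule hermitianI[OF psd_carrier[OF assms]])
  fix i j assume ij: "i < n" "j < n"
  show "A $$ (i, j) = cnj (A $$ (j, i))"
  proof (cases "i = j")
    case True
    then show ?thesis using psd_diag[OF assms ij(1)] by (simp add: complex_eq_iff)
  next
    case False
    have "Im (A $$ (i, i) + A $$ (i, j) + A $$ (j, i) + A $$ (j, j)) = 0"
      using psdD(1)[OF assms, of "\<lambda>k. if k = i then 1 else if k = j then 1 else 0"]
        quad_form_two_point[OF ij False, of A 1 1] by simp
    moreover have "Im (A $$ (i, i) + A $$ (i, j) * \<i> - \<i> * A $$ (j, i) + A $$ (j, j)) = 0"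
      using psdD(1)[OF assms, of "\<lambda>k. if k = i then 1 else if k = j then \<i> else 0"]
        quad_form_two_point[OF ij False, of A 1 \<i>] by simp
    ultimately show ?thesis using psd_diag[OF assms ij(1)] psd_diag[OF assms ij(2)]
      by (simp add: complex_eq_iff)
  qed
qed

lemma psd_mtrace: "psd n A \<Longrightarrow> 0 \<le> Re (mtrace A)"
  using psd_diag(2)[of n A] psd_carrier[of n A] by (auto simp: mtrace_def intro!: sum_nonneg)

lemma psd_diagonalization:
  assumes "psd n A"
  obtains U c where "U \<in> carrier_mat n n" "adj U * U = 1\<^sub>m n" "U * adj U = 1\<^sub>m n"
    "A = U * real_diag n c * adj U" "adj U * A * U = real_diag n c" "\<And>k. k < n \<Longrightarrow> 0 \<le> c k"
proof -
  obtain U c where U: "U \<in> carrier_mat n n" "adj U * U = 1\<^sub>m n" "U * adj U = 1\<^sub>m n"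
    and A: "A = U * real_diag n c * adj U"
    using hermitian_diagonalization[OF psd_carrier[OF assms] psd_hermitian[OF assms]] by blast
  note assoc = assoc_mult_mat[of _ n n _ n _ n] mult_carrier_mat[of _ n n _ n]
  have "adj U * A * U = (adj U * U) * real_diag n c * (adj U * U)"
    unfolding A using U(1) by (simp add: assoc)
  then have d: "adj U * A * U = real_diag n c"
    unfolding U(2) left_mult_one_mat[OF real_diag_carrier] right_mult_one_mat[OF real_diag_carrier] .
  have "0 \<le> c k" if "k < n" for k
    using psd_diag(2)[OF psd_conj[OF assms U(1)] that] that unfolding d by (simp add: real_diag_def)
  then show thesis using that U A d by blast
qed

lemma psd_square_root:
  assumes "psd n A"
  obtains S where "S \<in> carrier_mat n n" "adj S = S" "A = S * S"
proof -
  obtain U c where U: "U \<in> carrier_mat n n" "adj U * U = 1\<^sub>m n"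
    and A: "A = U * real_diag n c * adj U" and c: "\<And>k. k < n \<Longrightarrow> 0 \<le> c k"
    using psd_diagonalization[OF assms] by metis
  define R where "R = real_diag n (\<lambda>k. sqrt (c k))"
  have R: "R \<in> carrier_mat n n" "adj R = R" by (auto simp: R_def)
  have RR: "R * R = real_diag n c"
    unfolding R_def real_diag_mult by (rule eq_matI) (auto simp: real_diag_def c simp flip: of_real_mult)
  note assoc = assoc_mult_mat[of _ n n _ n _ n] mult_carrier_mat[of _ n n _ n]
  define S where "S = U * R * adj U"
  have "S * S = U * R * (adj U * U) * R * adj U" unfolding S_def using U(1) R by (simp add: assoc)
  also have "\<dots> = U * R * R * adj U" unfolding U(2) using U(1) R by (simp add: assoc)
  also have "\<dots> = U * (R * R) * adj U" using U(1) R by (simp add: assoc)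
  finally have "A = S * S" by (simp add: A RR)
  moreover have "adj S = S"
    unfolding S_def using U(1) R by (simp add: adj_mult[of _ n n _ n] assoc)
  ultimately show thesis using that[of S] U(1) R by (simp add: S_def assoc)
qed

text \<open>Writing \<open>Q = S * S\<close> with \<open>S\<close> Hermitian, cyclicity turns the
  trace into that of \<open>S * P * S\<close>, a conjugate of \<open>P\<close>.\<close>

lemma psd_mtrace_mult:
  assumes "psd n P" "psd n Q"
  shows "0 \<le> Re (mtrace (P * Q))"
proof -
  obtain S where S: "S \<in> carrier_mat n n" "adj S = S" "Q = S * S" using psd_square_root[OF assms(2)] .
  note P = psd_carrier[OF assms(1)]
  have "mtrace (P * Q) = mtrace (P * S * S)" using S P by (simp add: assoc_mult_mat[of _ n n _ n _ n])
  also have "\<dots> = mtrace (S * (P * S))" using S P by (intro mtrace_comm[of _ n n]) auto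
  also have "\<dots> = mtrace (adj S * P * S)" using S P by (simp add: assoc_mult_mat[of _ n n _ n _ n])
  finally show ?thesis using psd_mtrace[OF psd_conj[OF assms(1) S(1)]] by simp
qed


section \<open>Matrix sums over finite sets\<close>

definition set_msum :: "nat \<Rightarrow> ('b \<Rightarrow> complex mat) \<Rightarrow> 'b set \<Rightarrow> complex mat" where
  "set_msum n f I = mat n n (\<lambda>(i, j). \<Sum>x\<in>I. f x $$ (i, j))"

lemma set_msum_carrier [simp]: "set_msum n f I \<in> carrier_mat n n"
  by (simp add: set_msum_def)

lemma set_msum_empty [simp]: "set_msum n f {} = 0\<^sub>m n n"
  by (rule eq_matI) (auto simp: set_msum_def)

lemma set_msum_insert:
  assumes "finite I" "x \<notin> I" "f x \<in> carrier_mat n n"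
  shows "set_msum n f (insert x I) = f x + set_msum n f I"
  by (rule eq_matI) (use assms in \<open>auto simp: set_msum_def\<close>)

text \<open>The bridge to the list sums in the definitions of channels and codes. A list sum counts
  repeated elements, hence the distinctness.\<close>

lemma msum_eq_set_msum:
  assumes "distinct xs" "\<And>x. x \<in> set xs \<Longrightarrow> f x \<in> carrier_mat n n"
  shows "msum n f xs = set_msum n f (set xs)"
  using assms by (induction xs) (auto simp: msum_def set_msum_insert)

lemma set_msum_mult_right:
  assumes "\<And>x. x \<in> I \<Longrightarrow> f x \<in> carrier_mat n n" "B \<in> carrier_mat n n"
  shows "set_msum n f I * B = set_msum n (\<lambda>x. f x * B) I"
proof (rule eq_matI)
  fix i j assume "i < dim_row (set_msum n (\<lambda>x. f x * B) I)" "j < dim_col (set_msum n (\<lambda>x. f x * B) I)"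
  then have ij: "i < n" "j < n" by (auto simp: set_msum_def)
  have "(set_msum n f I * B) $$ (i, j) = (\<Sum>l<n. \<Sum>x\<in>I. f x $$ (i, l) * B $$ (l, j))"
    unfolding mult_mat_entry[OF set_msum_carrier assms(2) ij]
    by (rule sum.cong) (use ij in \<open>auto simp: set_msum_def sum_distrib_right\<close>)
  also have "\<dots> = (\<Sum>x\<in>I. \<Sum>l<n. f x $$ (i, l) * B $$ (l, j))" by (rule sum.swap)
  also have "\<dots> = (\<Sum>x\<in>I. (f x * B) $$ (i, j))"
    by (rule sum.cong) (auto simp only: mult_mat_entry[OF assms(1) assms(2) ij])
  finally show "(set_msum n f I * B) $$ (i, j) = set_msum n (\<lambda>x. f x * B) I $$ (i, j)"
    using ij by (simp add: set_msum_def)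
qed (use assms in \<open>auto simp: set_msum_def\<close>)

lemma set_msum_mult_left:
  assumes "\<And>x. x \<in> I \<Longrightarrow> f x \<in> carrier_mat n n" "B \<in> carrier_mat n n"
  shows "B * set_msum n f I = set_msum n (\<lambda>x. B * f x) I"
proof (rule eq_matI)
  fix i j assume "i < dim_row (set_msum n (\<lambda>x. B * f x) I)" "j < dim_col (set_msum n (\<lambda>x. B * f x) I)"
  then have ij: "i < n" "j < n" by (auto simp: set_msum_def)
  have "(B * set_msum n f I) $$ (i, j) = (\<Sum>l<n. \<Sum>x\<in>I. B $$ (i, l) * f x $$ (l, j))"
    unfolding mult_mat_entry[OF assms(2) set_msum_carrier ij]
    by (rule sum.cong) (use ij in \<open>auto simp: set_msum_def sum_distrib_left\<close>)
  also have "\<dots> = (\<Sum>x\<in>I. \<Sum>l<n. B $$ (i, l) * f x $$ (l, j))" by (rule sum.swap)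
  also have "\<dots> = (\<Sum>x\<in>I. (B * f x) $$ (i, j))"
    by (rule sum.cong) (auto simp only: mult_mat_entry[OF assms(2) assms(1) ij])
  finally show "(B * set_msum n f I) $$ (i, j) = set_msum n (\<lambda>x. B * f x) I $$ (i, j)"
    using ij by (simp add: set_msum_def)
qed (use assms in \<open>auto simp: set_msum_def\<close>)

lemma mtrace_set_msum:
  assumes "\<And>x. x \<in> I \<Longrightarrow> f x \<in> carrier_mat n n"
  shows "mtrace (set_msum n f I) = (\<Sum>x\<in>I. mtrace (f x))"
proof -
  have "mtrace (set_msum n f I) = (\<Sum>i<n. \<Sum>x\<in>I. f x $$ (i, i))"
    by (simp add: mtrace_def set_msum_def)
  also have "\<dots> = (\<Sum>x\<in>I. \<Sum>i<n. f x $$ (i, i))" by (rule sum.swap)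
  also have "\<dots> = (\<Sum>x\<in>I. mtrace (f x))"
    by (rule sum.cong) (use assms in \<open>auto simp: mtrace_def\<close>)
  finally show ?thesis .
qed

lemma psd_set_msum:
  assumes "finite I" "\<And>x. x \<in> I \<Longrightarrow> psd n (f x)"
  shows "psd n (set_msum n f I)"
  using assms
proof (induction I)
  case (insert x I)
  then show ?case by (subst set_msum_insert) (auto intro: psd_add psd_carrier)
qed (simp add: psd_zero)

section \<open>The pretty good measurement\<close>

text \<open>This is the operator inequality \<open>T * T \<le> T\<close> read off on the diagonal:
  for Hermitian \<open>T\<close> the squared norm of row \<open>k\<close> is the diagonal entry of
  \<open>T * T\<close>.\<close>

lemma effect_row_norm:
  assumes "effect n T" "k < n"
  shows "(\<Sum>l<n. (cmod (T $$ (k, l)))\<^sup>2) \<le> Re (T $$ (k, k))"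
proof -
  have T: "psd n T" and T1: "psd n (1\<^sub>m n - T)" using assms by (auto simp: effect_def)
  note c = psd_carrier[OF T] psd_carrier[OF T1]
  define P where "P = T - T * T"
  have P: "P \<in> carrier_mat n n" using c by (simp add: P_def mult_carrier_mat[of _ n n _ n] minus_carrier_mat)
  have 1: "T * (1\<^sub>m n - T) = P" "(1\<^sub>m n - T) * T = P"
    using c by (auto simp: P_def mult_minus_distrib_mat[of _ n n _ n] minus_mult_distrib_mat[of _ n n _ _ n])
  \<comment> \<open>Both summands are conjugates of positive matrices, and they add up to
    \<open>P = T - T * T\<close> since \<open>T\<close> and \<open>1 - T\<close> sum to the
    identity.\<close>
  have "psd n (adj T * (1\<^sub>m n - T) * T + adj (1\<^sub>m n - T) * T * (1\<^sub>m n - T))"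
    by (intro psd_add psd_conj[OF T1 c(1)] psd_conj[OF T c(2)])
  also have "adj T * (1\<^sub>m n - T) * T + adj (1\<^sub>m n - T) * T * (1\<^sub>m n - T) = P * T + P * (1\<^sub>m n - T)"
    unfolding psd_hermitian[OF T] psd_hermitian[OF T1] 1 ..
  also have "\<dots> = P"
    unfolding mult_minus_distrib_mat[OF P one_carrier_mat c(1)] right_mult_one_mat[OF P]
    by (rule eq_matI) (use P c in auto)
  finally have "0 \<le> Re (P $$ (k, k))" using psd_diag assms(2) by blast
  moreover have "P $$ (k, k) = T $$ (k, k) - (\<Sum>l<n. T $$ (k, l) * T $$ (l, k))"
    using c assms(2) by (simp add: P_def mult_mat_entry[of _ n n _ n] del: index_mult_mat(1))
  moreover have "Re (T $$ (k, l) * T $$ (l, k)) = (cmod (T $$ (k, l)))\<^sup>2" if "l < n" for l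
    using hermitianD[OF psd_hermitian[OF T] c(1) assms(2) that] complex_norm_square[of "T $$ (k, l)"]
    by (metis Re_complex_of_real)
  ultimately show ?thesis by simp
qed

lemma effect_unitary_conj:
  assumes "effect n T" "U \<in> carrier_mat n n" "adj U * U = 1\<^sub>m n"
  shows "effect n (adj U * T * U)"
proof -
  have T: "psd n T" and T1: "psd n (1\<^sub>m n - T)" using assms by (auto simp: effect_def)
  note c = psd_carrier[OF T] assms(2) adj_carrier[OF assms(2)]
  have "adj U * (1\<^sub>m n - T) * U = adj U * U - adj U * T * U"
    using c by (simp add: mult_minus_distrib_mat[of _ n n _ n] minus_mult_distrib_mat[of _ n n _ _ n]
        mult_carrier_mat[of _ n n _ n])
  then show ?thesis
    using psd_conj[OF T assms(2)] psd_conj[OF T1 assms(2)] assms(3) by (simp add: effect_def)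
qed

lemma mtrace_unitary_conj:
  assumes "A \<in> carrier_mat n n" "B \<in> carrier_mat n n" "U \<in> carrier_mat n n" "U * adj U = 1\<^sub>m n"
  shows "mtrace ((adj U * A * U) * (adj U * B * U)) = mtrace (A * B)"
proof -
  note assoc = assoc_mult_mat[of _ n n _ n _ n] mult_carrier_mat[of _ n n _ n]
  note c = assms(1-3) adj_carrier[OF assms(3)]
  have "(adj U * A * U) * (adj U * B * U) = adj U * A * (U * adj U) * B * U"
    using c by (simp add: assoc)
  also have "\<dots> = adj U * (A * B * U)" unfolding assms(4) using c by (simp add: assoc)
  finally have "mtrace ((adj U * A * U) * (adj U * B * U)) = mtrace (A * B * U * adj U)"
    using c mtrace_comm[of "adj U" n n "A * B * U"] by (simp add: assoc)
  also have "A * B * U * adj U = A * B * (U * adj U)" using c by (simp add: assoc)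
  finally show ?thesis
    unfolding assms(4) right_mult_one_mat[OF mult_carrier_mat[OF c(1,2)]] .
qed

text \<open>The measurement inequality in coordinates: \<open>c\<close> stands for the eigenvalues
  of the total operator and \<open>t\<close> for the diagonal of the test. The weights are geometric
  means, so that the first sum on the right is exactly the success term of the pretty good
  measurement.\<close>

lemma weighted_square_completion:
  fixes A T :: "nat \<Rightarrow> nat \<Rightarrow> complex" and c :: "nat \<Rightarrow> real"
  assumes c: "\<And>k. k < n \<Longrightarrow> 0 < c k"
    and hT: "\<And>k l. k < n \<Longrightarrow> l < n \<Longrightarrow> T l k = cnj (T k l)"
    and row: "\<And>k. k < n \<Longrightarrow> (\<Sum>l<n. (cmod (T k l))\<^sup>2) \<le> t k"
  shows "2 * (\<Sum>k<n. \<Sum>l<n. Re (A k l * T l k)) \<le>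
    (\<Sum>k<n. \<Sum>l<n. (cmod (A k l))\<^sup>2 / (sqrt (c k) * sqrt (c l))) + (\<Sum>k<n. c k * t k)"
proof -
  define q where "q k l = (cmod (T k l))\<^sup>2" for k l
  have q: "q l k = q k l" if "k < n" "l < n" for k l using hT[OF that] by (simp add: q_def)
  have "2 * Re (A k l * T l k) \<le> (cmod (A k l))\<^sup>2 / (sqrt (c k) * sqrt (c l)) + (c k * q k l + c l * q l k) / 2"
    if kl: "k < n" "l < n" for k l
  proof -
    define s where "s = sqrt (c k) * sqrt (c l)"
    have s: "s > 0" using c kl by (simp add: s_def)
    \<comment> \<open>The arithmetic mean separates the two indices, so that only weighted row norms
      of \<open>T\<close> remain after summation.\<close>
    have s2: "s \<le> (c k + c l) / 2"
      using arith_geo_mean_sqrt[of "c k" "c l"] c[OF kl(1)] c[OF kl(2)] by (simp add: s_def real_sqrt_mult)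
    have "Re (A k l * T l k) \<le> cmod (A k l) * cmod (T k l)"
      using complex_Re_le_cmod[of "A k l * T l k"] hT[OF kl] by (simp add: norm_mult)
    moreover have "2 * (cmod (A k l) * cmod (T k l)) \<le> (cmod (A k l))\<^sup>2 / s + s * q k l"
    proof -
      have "0 \<le> (cmod (A k l) - s * cmod (T k l))\<^sup>2 / s" using s by simp
      also have "\<dots> = (cmod (A k l))\<^sup>2 / s + s * q k l - 2 * (cmod (A k l) * cmod (T k l))"
        using s by (simp add: q_def field_simps power2_eq_square)
      finally show ?thesis by simp
    qed
    moreover have "s * q k l \<le> (c k + c l) / 2 * q k l" using s2 by (rule mult_right_mono) (simp add: q_def)
    ultimately show ?thesis using q[OF kl] by (simp add: s_def field_simps)
  qed
  then have "(\<Sum>k<n. \<Sum>l<n. 2 * Re (A k l * T l k)) \<le>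
    (\<Sum>k<n. \<Sum>l<n. (cmod (A k l))\<^sup>2 / (sqrt (c k) * sqrt (c l)) + (c k * q k l + c l * q l k) / 2)"
    by (intro sum_mono) auto
  also have "\<dots> = (\<Sum>k<n. \<Sum>l<n. (cmod (A k l))\<^sup>2 / (sqrt (c k) * sqrt (c l)))
     + ((\<Sum>k<n. \<Sum>l<n. c k * q k l) + (\<Sum>k<n. \<Sum>l<n. c l * q l k)) / 2"
    by (simp add: sum.distrib add_divide_distrib sum_divide_distrib)
  \<comment> \<open>The two halves differ only by the names of the summation indices and recombine
    into one sum.\<close>
  also have "(\<Sum>k<n. \<Sum>l<n. c l * q l k) = (\<Sum>k<n. \<Sum>l<n. c k * q k l)" by (rule sum.swap)
  finally have "(\<Sum>k<n. \<Sum>l<n. 2 * Re (A k l * T l k)) \<le>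
    (\<Sum>k<n. \<Sum>l<n. (cmod (A k l))\<^sup>2 / (sqrt (c k) * sqrt (c l))) + (\<Sum>k<n. \<Sum>l<n. c k * q k l)"
    by (simp only: add_divide_distrib field_sum_of_halves)
  also have "(\<Sum>k<n. \<Sum>l<n. 2 * Re (A k l * T l k)) = 2 * (\<Sum>k<n. \<Sum>l<n. Re (A k l * T l k))"
    by (simp only: sum_distrib_left)
  moreover have "(\<Sum>k<n. \<Sum>l<n. c k * q k l) \<le> (\<Sum>k<n. c k * t k)"
    unfolding sum_distrib_left[symmetric]
    by (intro sum_mono mult_left_mono) (use row c in \<open>auto simp: q_def less_imp_le\<close>)
  ultimately show ?thesis by (metis (no_types, lifting) add_left_mono order_trans)
qed

text \<open>The lower bound \<open>r\<close> on \<open>C\<close> keeps its eigenvalues positive, so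
  that the inverse square root of \<open>C\<close> exists and the normalised operators sum to the
  identity exactly.\<close>

lemma pretty_good_measurement_definite:
  assumes fin: "finite X" and A: "\<And>x. x \<in> X \<Longrightarrow> psd n (A x)"
    and C: "C = set_msum n A X" and r: "0 < r" "psd n (C - complex_of_real r \<cdot>\<^sub>m 1\<^sub>m n)"
  obtains D where "\<And>x. x \<in> X \<Longrightarrow> psd n (D x)" "set_msum n D X = 1\<^sub>m n"
    "\<And>x T. x \<in> X \<Longrightarrow> effect n T \<Longrightarrow>
      2 * Re (mtrace (A x * T)) \<le> Re (mtrace (A x * D x)) + Re (mtrace (C * T))"
proof -
  have pC: "psd n C" unfolding C by (rule psd_set_msum[OF fin A])
  have Cc: "C \<in> carrier_mat n n" by (simp add: C)
  obtain U c where U: "U \<in> carrier_mat n n" "adj U * U = 1\<^sub>m n" "U * adj U = 1\<^sub>m n"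
    and CU: "C = U * real_diag n c * adj U" and UC: "adj U * C * U = real_diag n c"
    by (rule psd_diagonalization[OF pC]) blast
  note assoc = assoc_mult_mat[of _ n n _ n _ n] mult_carrier_mat[of _ n n _ n]
  have cpos: "0 < c k" if k: "k < n" for k
  proof -
    \<comment> \<open>Conjugation by \<open>U\<close> turns the shifted matrix into the diagonal
      matrix with entries \<open>c k - r\<close>.\<close>
    have "adj U * (C - complex_of_real r \<cdot>\<^sub>m 1\<^sub>m n) * U = adj U * C * U - complex_of_real r \<cdot>\<^sub>m (adj U * U)"
      using U(1) Cc by (simp add: mult_minus_distrib_mat[of _ n n _ n] minus_mult_distrib_mat[of _ n n _ _ n]
        mult_carrier_mat[of _ n n _ n] mult_smult_distrib[of _ n n _ n] mult_smult_assoc_mat[of _ n n _ n])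
    also have "\<dots> $$ (k, k) = of_real (c k - r)" unfolding UC U(2) using k by (simp add: real_diag_def)
    finally show ?thesis using psd_diag(2)[OF psd_conj[OF r(2) U(1)] k] r(1) by simp
  qed
  define R where "R = real_diag n (\<lambda>k. 1 / sqrt (c k))"
  have R: "R \<in> carrier_mat n n" "adj R = R" by (auto simp: R_def)
  \<comment> \<open>\<open>K\<close> is the inverse square root of \<open>C\<close>.\<close>
  define K where "K = U * R * adj U"
  have K: "K \<in> carrier_mat n n" using U(1) R(1) by (simp add: K_def assoc)
  have aK: "adj K = K" unfolding K_def using U(1) R by (simp add: adj_mult[of _ n n _ n] assoc)
  have KCK: "K * C * K = 1\<^sub>m n"
  proof -
    have "K * C * K = U * R * (adj U * C * U) * R * adj U"
      unfolding K_def using U(1) R Cc by (simp add: assoc)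
    also have "\<dots> = U * (R * real_diag n c * R) * adj U" unfolding UC using U(1) R by (simp add: assoc)
    also have "R * real_diag n c * R = 1\<^sub>m n"
      unfolding R_def real_diag_mult
      by (rule eq_matI) (use cpos in \<open>auto simp: real_diag_def less_imp_le less_imp_neq[THEN not_sym] simp flip: of_real_mult\<close>)
    finally show ?thesis using U by simp
  qed
  define D where "D x = K * A x * K" for x
  show thesis
  proof (rule that[of D])
    show "psd n (D x)" if "x \<in> X" for x
      using psd_conj[OF A[OF that] K] by (simp add: D_def aK)
    show "set_msum n D X = 1\<^sub>m n"
    proof -
      have "set_msum n D X = set_msum n (\<lambda>x. K * A x) X * K"
        unfolding D_def using A K by (intro set_msum_mult_right[symmetric]) (auto simp: psd_carrier assoc)
      also have "set_msum n (\<lambda>x. K * A x) X = K * C"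
        unfolding C using A K by (intro set_msum_mult_left[symmetric]) (auto simp: psd_carrier)
      finally show ?thesis by (simp add: KCK)
    qed
    fix x T assume x: "x \<in> X" and T: "effect n T"
    have Ac: "A x \<in> carrier_mat n n" and Tc: "T \<in> carrier_mat n n" and Dc: "D x \<in> carrier_mat n n"
      using A[OF x] T K by (auto simp: psd_carrier effect_def D_def assoc)
    \<comment> \<open>From here on everything is expressed in the eigenbasis of
      \<open>C\<close>.\<close>
    define A' where "A' = adj U * A x * U"
    define T' where "T' = adj U * T * U"
    define D' where "D' = adj U * D x * U"
    have c': "A' \<in> carrier_mat n n" "T' \<in> carrier_mat n n" "D' \<in> carrier_mat n n"
      using U(1) Ac Tc Dc by (auto simp: A'_def T'_def D'_def assoc)
    have pA': "psd n A'" unfolding A'_def by (rule psd_conj[OF A[OF x] U(1)])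
    have eT': "effect n T'" unfolding T'_def by (rule effect_unitary_conj[OF T U(1,2)])
    have hA': "A' $$ (l, k) = cnj (A' $$ (k, l))" if "k < n" "l < n" for k l
      using hermitianD[OF psd_hermitian[OF pA'] c'(1) that] by simp
    have hT': "T' $$ (l, k) = cnj (T' $$ (k, l))" if "k < n" "l < n" for k l
      using hermitianD[OF psd_hermitian[of n] c'(2) that] eT' by (simp add: effect_def)
    have D'A': "D' = R * A' * R"
    proof -
      have "D' = (adj U * U) * R * (adj U * A x * U) * R * (adj U * U)"
        unfolding D'_def D_def K_def using U(1) R Ac by (simp add: assoc)
      then show ?thesis unfolding U(2) A'_def using U(1) R Ac by (simp add: assoc)
    qed
    \<comment> \<open>The indices are transposed because the trace pairs entry \<open>(k, l)\<close>
      of \<open>A'\<close> with entry \<open>(l, k)\<close> of \<open>D'\<close>; by Hermiticity of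
      \<open>A'\<close> the product is a squared modulus divided by the weight.\<close>
    have D'e: "D' $$ (l, k) = A' $$ (l, k) / of_real (sqrt (c k) * sqrt (c l))" if "k < n" "l < n" for k l
      unfolding D'A' R_def using c' that
      by (simp add: real_diag_mult_right[of _ n n] real_diag_mult_left[of _ n n] mult_carrier_mat[of _ n n _ n]
          del: index_mult_mat(1))
    have 1: "Re (mtrace (A x * T)) = (\<Sum>k<n. \<Sum>l<n. Re (A' $$ (k, l) * T' $$ (l, k)))"
      unfolding mtrace_unitary_conj[OF Ac Tc U(1,3), symmetric] A'_def[symmetric] T'_def[symmetric]
        mtrace_mult[OF c'(1,2)] by simp
    have 2: "Re (mtrace (A x * D x)) = (\<Sum>k<n. \<Sum>l<n. (cmod (A' $$ (k, l)))\<^sup>2 / (sqrt (c k) * sqrt (c l)))"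
    proof -
      have "Re (mtrace (A x * D x)) = (\<Sum>k<n. \<Sum>l<n. Re (A' $$ (k, l) * D' $$ (l, k)))"
        unfolding mtrace_unitary_conj[OF Ac Dc U(1,3), symmetric] A'_def[symmetric] D'_def[symmetric]
          mtrace_mult[OF c'(1,3)] by simp
      also have "\<dots> = (\<Sum>k<n. \<Sum>l<n. (cmod (A' $$ (k, l)))\<^sup>2 / (sqrt (c k) * sqrt (c l)))"
      proof (intro sum.cong refl)
        fix k l assume "k \<in> {..<n}" "l \<in> {..<n}"
        then have kl: "k < n" "l < n" by auto
        have "A' $$ (k, l) * D' $$ (l, k) = of_real ((cmod (A' $$ (k, l)))\<^sup>2 / (sqrt (c k) * sqrt (c l)))"
          unfolding D'e[OF kl] hA'[OF kl] of_real_divide complex_norm_square by simp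
        then show "Re (A' $$ (k, l) * D' $$ (l, k)) = (cmod (A' $$ (k, l)))\<^sup>2 / (sqrt (c k) * sqrt (c l))"
          by (simp only: Re_complex_of_real)
      qed
      finally show ?thesis .
    qed
    have 3: "Re (mtrace (C * T)) = (\<Sum>k<n. c k * Re (T' $$ (k, k)))"
    proof -
      have "mtrace (C * T) = mtrace (real_diag n c * T')"
        unfolding mtrace_unitary_conj[OF Cc Tc U(1,3), symmetric] UC T'_def ..
      also have "\<dots> = (\<Sum>k<n. of_real (c k) * T' $$ (k, k))"
        unfolding mtrace_def
        by (rule sum.cong) (use c' in \<open>auto simp: real_diag_mult_left[OF c'(2)] carrier_matD[OF real_diag_carrier] simp del: index_mult_mat(1)\<close>)
      finally show ?thesis by simp
    qed
    show "2 * Re (mtrace (A x * T)) \<le> Re (mtrace (A x * D x)) + Re (mtrace (C * T))"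
      unfolding 1 2 3
      by (rule weighted_square_completion[OF cpos hT' effect_row_norm[OF eT']])
  qed
qed

text \<open>Since \<open>\<Sum>\<^sub>x W\<^sub>x\<close> may be singular, a small multiple of the identity is added to each \<open>W\<^sub>x\<close>;
  this costs the slack \<open>d\<close>.\<close>

theorem pretty_good_measurement:
  assumes fin: "finite X" and ne: "X \<noteq> {}" and W: "\<And>x. x \<in> X \<Longrightarrow> psd n (W x)" and d: "0 < d"
  obtains D where "\<And>x. x \<in> X \<Longrightarrow> psd n (D x)" "set_msum n D X = 1\<^sub>m n"
    "\<And>x T. x \<in> X \<Longrightarrow> effect n T \<Longrightarrow>
      2 * Re (mtrace (W x * T)) \<le> Re (mtrace (W x * D x)) + (\<Sum>y\<in>X. Re (mtrace (W y * T))) + d"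
proof -
  \<comment> \<open>The perturbation costs at most \<open>r * n\<close> in the success term and
    \<open>card X * r * n\<close> in the total term. The denominator keeps the sum below
    \<open>d\<close>, and the added ones keep it positive even for \<open>n = 0\<close>.\<close>
  define r where "r = d / ((real (card X) + 1) * (real n + 1))"
  have r: "r > 0" using d by (simp add: r_def add_pos_nonneg)
  let ?I = "complex_of_real r \<cdot>\<^sub>m 1\<^sub>m n"
  define A where "A x = W x + ?I" for x
  define C where "C = set_msum n A X"
  have I: "psd n ?I" using r by (intro psd_smult psd_one) auto
  have pA: "psd n (A x)" if "x \<in> X" for x unfolding A_def using W[OF that] I by (rule psd_add)
  obtain x0 where x0: "x0 \<in> X" using ne by blast
  \<comment> \<open>The identity part of the single summand \<open>x0\<close> already supplies the
    lower bound on \<open>C\<close>; this is where nonemptiness of \<open>X\<close> enters.\<close>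
  have "C = A x0 + set_msum n A (X - {x0})"
    unfolding C_def using set_msum_insert[of "X - {x0}" x0 A n] fin x0 pA by (simp add: insert_absorb psd_carrier)
  then have "C - ?I = W x0 + set_msum n A (X - {x0})"
    unfolding A_def[of x0] using psd_carrier[OF W[OF x0]]
    by (intro eq_matI) (auto simp: set_msum_def)
  then have "psd n (C - ?I)"
    using psd_add[OF W[OF x0] psd_set_msum[of "X - {x0}" n A]] fin pA by auto
  from pretty_good_measurement_definite[OF fin pA C_def r this]
  obtain D where D: "\<And>x. x \<in> X \<Longrightarrow> psd n (D x)" "set_msum n D X = 1\<^sub>m n"
    and le: "\<And>x T. x \<in> X \<Longrightarrow> effect n T \<Longrightarrow>
      2 * Re (mtrace (A x * T)) \<le> Re (mtrace (A x * D x)) + Re (mtrace (C * T))"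
    by blast
  show thesis
  proof (rule that[OF D])
    fix x T assume x: "x \<in> X" and T: "effect n T"
    have Tc: "T \<in> carrier_mat n n" and T0: "0 \<le> Re (mtrace T)"
      using T psd_mtrace by (auto simp: effect_def psd_carrier)
    have Tn: "Re (mtrace T) \<le> real n"
      using psd_mtrace[of n "1\<^sub>m n - T"] T Tc by (simp add: effect_def mtrace_minus[of _ n] mtrace_one)
    \<comment> \<open>The traces of all outcomes are nonnegative and add up to the trace of the
      identity.\<close>
    have Dn: "Re (mtrace (D x)) \<le> real n"
    proof -
      have "Re (mtrace (D x)) \<le> (\<Sum>y\<in>X. Re (mtrace (D y)))"
        by (rule member_le_sum[OF x _ fin]) (use psd_mtrace D(1) in blast)
      also have "\<dots> = real n"
        using arg_cong[OF mtrace_set_msum[of X D n], of Re] D by (simp add: psd_carrier mtrace_one)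
      finally show ?thesis .
    qed
    have AT: "Re (mtrace (A y * B)) = Re (mtrace (W y * B)) + r * Re (mtrace B)"
      if "y \<in> X" "B \<in> carrier_mat n n" for y B
    proof -
      have "A y * B = W y * B + complex_of_real r \<cdot>\<^sub>m B"
        unfolding A_def using psd_carrier[OF W[OF that(1)]] that(2)
        by (simp add: add_mult_distrib_mat[of _ n n _ _ n] mult_smult_assoc_mat[of _ n n _ n])
      then show ?thesis
        using psd_carrier[OF W[OF that(1)]] that(2) by (simp add: mtrace_add[of _ n] mtrace_smult[of _ n])
    qed
    have "Re (mtrace (C * T)) = (\<Sum>y\<in>X. Re (mtrace (A y * T)))"
      unfolding C_def using pA Tc
      by (subst set_msum_mult_right) (auto simp: psd_carrier mult_carrier_mat[of _ n n _ n] mtrace_set_msum[where f = "\<lambda>x. A x * T" and n = n])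
    also have "\<dots> = (\<Sum>y\<in>X. Re (mtrace (W y * T))) + real (card X) * (r * Re (mtrace T))"
      using AT Tc by (simp add: sum.distrib)
    finally have CT: "Re (mtrace (C * T)) = \<dots>" .
    have "2 * Re (mtrace (W x * T)) \<le> 2 * Re (mtrace (A x * T))"
      using AT[OF x Tc] r T0 by simp
    also have "\<dots> \<le> Re (mtrace (A x * D x)) + Re (mtrace (C * T))" by (rule le[OF x T])
    also have "\<dots> \<le> Re (mtrace (W x * D x)) + (\<Sum>y\<in>X. Re (mtrace (W y * T))) + (real (card X) + 1) * (r * real n)"
    proof -
      have "r * Re (mtrace (D x)) \<le> r * real n" using Dn r by (intro mult_left_mono) auto
      moreover have "real (card X) * (r * Re (mtrace T)) \<le> real (card X) * (r * real n)"
        using Tn r by (intro mult_left_mono) auto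
      moreover have "(real (card X) + 1) * (r * real n) = real (card X) * (r * real n) + r * real n"
        by (simp add: algebra_simps)
      ultimately show ?thesis unfolding AT[OF x psd_carrier[OF D(1)[OF x]]] CT by linarith
    qed
    also have "(real (card X) + 1) * (r * real n) \<le> d"
    proof -
      have "(real (card X) + 1) * (r * real n) = d * (real n / (real n + 1))"
      proof -
        have "a * (d / (a * b) * real n) = d * (real n / b)" if "a \<noteq> 0" for a b :: real
          using that by simp
        then show ?thesis unfolding r_def by this linarith
      qed
      also have "\<dots> \<le> d * 1" using d by (intro mult_left_mono) auto
      finally show ?thesis by simp
    qed
    finally show "2 * Re (mtrace (W x * T)) \<le> Re (mtrace (W x * D x)) + (\<Sum>y\<in>X. Re (mtrace (W y * T))) + d" by simp
  qed
qed


section \<open>Channels in coordinates\<close>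

lemma sum_lessThan_mult:
  fixes f :: "nat \<Rightarrow> 'a :: comm_monoid_add"
  shows "(\<Sum>p<m * d. f p) = (\<Sum>a<m. \<Sum>e<d. f (a * d + e))"
proof -
  have "(\<Sum>e\<in>{a * d..<a * d + d}. f e) = (\<Sum>e<d. f (a * d + e))" for a
    by (subst sum.atLeastLessThan_shift_0) (simp add: atLeast0LessThan)
  then show ?thesis by (simp flip: sum.nat_group)
qed

lemma mult_add_less: "a < m \<Longrightarrow> e < d \<Longrightarrow> a * d + e < m * (d :: nat)"
  proof -
  assume "a < m" "e < d"
  then have "Suc a \<le> m" by simp
  from mult_le_mono1[OF this, of d] \<open>e < d\<close> show ?thesis by simp
qed

lemma mult_add_index:
  assumes "p < m * (d :: nat)"
  obtains a e where "a < m" "e < d" "p = a * d + e"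
proof -
  have "d > 0" using assms by (cases d) auto
  then show thesis using that[of "p div d" "p mod d"] assms by (simp add: less_mult_imp_div_less)
qed

lemma msum_carrier:
  "(\<And>x. x \<in> set xs \<Longrightarrow> f x \<in> carrier_mat n n) \<Longrightarrow> msum n f xs \<in> carrier_mat n n"
  by (induction xs) (auto simp: msum_def)

lemma msum_entry:
  assumes "\<And>x. x \<in> set xs \<Longrightarrow> f x \<in> carrier_mat n n" "i < n" "j < n"
  shows "msum n f xs $$ (i, j) = (\<Sum>k<length xs. f (xs ! k) $$ (i, j))"
  using assms(1)
proof (induction xs)
  case Nil
  then show ?case using assms by (simp add: msum_def)
next
  case (Cons x xs)
  have "msum n f (x # xs) = f x + msum n f xs" by (simp add: msum_def)
  then show ?case
    using Cons assms(2,3) carrier_matD[OF msum_carrier[of xs f n]]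
    by (simp add: sum.lessThan_Suc_shift del: sum.lessThan_Suc)
qed

lemma conj_entry:
  assumes "K \<in> carrier_mat m n" "X \<in> carrier_mat n n" "b < m" "b' < m"
  shows "(K * X * adj K) $$ (b, b') = (\<Sum>a<n. \<Sum>a'<n. K $$ (b, a) * X $$ (a, a') * cnj (K $$ (b', a')))"
proof -
  have KX: "K * X \<in> carrier_mat m n" using assms by simp
  have "(K * X * adj K) $$ (b, b') = (\<Sum>a'<n. \<Sum>a<n. K $$ (b, a) * X $$ (a, a') * cnj (K $$ (b', a')))"
    unfolding mult_mat_entry[OF KX adj_carrier[OF assms(1)] assms(3,4)]
    by (rule sum.cong) (use assms in \<open>auto simp: mult_mat_entry[OF assms(1,2)] adj_entry[OF assms(1)]
          sum_distrib_right simp del: index_mult_mat(1)\<close>)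
  also have "\<dots> = (\<Sum>a<n. \<Sum>a'<n. K $$ (b, a) * X $$ (a, a') * cnj (K $$ (b', a')))" by (rule sum.swap)
  finally show ?thesis .
qed

text \<open>A Kraus decomposition in coordinates, with \<open>K k b a\<close> the entry
  \<open>(b, a)\<close> of the operator numbered \<open>k\<close>. The second conjunct is trace
  preservation.\<close>

definition kraus_rep ::
  "nat \<Rightarrow> nat \<Rightarrow> (complex mat \<Rightarrow> complex mat) \<Rightarrow> nat \<Rightarrow> (nat \<Rightarrow> nat \<Rightarrow> nat \<Rightarrow> complex) \<Rightarrow> bool" where
  "kraus_rep m n N r K \<longleftrightarrow>
    (\<forall>X\<in>carrier_mat m m. \<forall>b<n. \<forall>b'<n.
       N X $$ (b, b') = (\<Sum>k<r. \<Sum>a<m. \<Sum>a'<m. K k b a * X $$ (a, a') * cnj (K k b' a'))) \<and>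
    (\<forall>a<m. \<forall>a'<m. (\<Sum>k<r. \<Sum>b<n. cnj (K k b a) * K k b a') = (if a = a' then 1 else 0))"

lemma channel_kraus:
  assumes "channel m n N"
  obtains r K where "kraus_rep m n N r K"
proof -
  obtain Ks where Ks: "set Ks \<subseteq> carrier_mat n m" "msum m (\<lambda>K. adj K * K) Ks = 1\<^sub>m m"
    "\<And>X. X \<in> carrier_mat m m \<Longrightarrow> N X = msum n (\<lambda>K. K * X * adj K) Ks"
    using assms by (auto simp: channel_def)
  have c: "Ks ! k \<in> carrier_mat n m" if "k < length Ks" for k using Ks(1) that by auto
  have "kraus_rep m n N (length Ks) (\<lambda>k b a. Ks ! k $$ (b, a))"
    unfolding kraus_rep_def
  proof (intro conjI ballI allI impI)
    fix X :: "complex mat" and b b' assume X: "X \<in> carrier_mat m m" and b: "b < n" "b' < n"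
    have "N X $$ (b, b') = (\<Sum>k<length Ks. (Ks ! k * X * adj (Ks ! k)) $$ (b, b'))"
      unfolding Ks(3)[OF X] by (rule msum_entry) (use Ks(1) X b in \<open>auto simp: subset_iff mult_carrier_mat[of _ n m _ n]\<close>)
    then show "N X $$ (b, b') = (\<Sum>k<length Ks. \<Sum>a<m. \<Sum>a'<m. Ks ! k $$ (b, a) * X $$ (a, a') * cnj (Ks ! k $$ (b', a')))"
      by (simp add: conj_entry[OF c X b] del: index_mult_mat(1))
  next
    fix a a' assume a: "a < m" "a' < m"
    have "(1\<^sub>m m :: complex mat) $$ (a, a') = (\<Sum>k<length Ks. (adj (Ks ! k) * Ks ! k) $$ (a, a'))"
      unfolding Ks(2)[symmetric] by (rule msum_entry) (use Ks(1) a in \<open>auto simp: subset_iff mult_carrier_mat[of _ m n _ m]\<close>)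
    also have "\<dots> = (\<Sum>k<length Ks. \<Sum>b<n. cnj (Ks ! k $$ (b, a)) * Ks ! k $$ (b, a'))"
      using a by (intro sum.cong refl)
        (simp add: mult_mat_entry[OF adj_carrier[OF c] c] adj_entry[OF c] del: index_mult_mat(1))
    finally show "(\<Sum>k<length Ks. \<Sum>b<n. cnj (Ks ! k $$ (b, a)) * Ks ! k $$ (b, a')) = (if a = a' then 1 else 0)"
      using a by simp
  qed
  then show thesis by (rule that)
qed

lemma tensor_id_carrier [simp]: "tensor_id N m n d \<rho> \<in> carrier_mat (n * d) (n * d)"
  by (simp add: tensor_id_def)

lemma tensor_id_entry:
  assumes N: "kraus_rep m n N r K"
    and b: "b < n" "b' < n" and e: "e < d" "e' < d"
  shows "tensor_id N m n d \<rho> $$ (b * d + e, b' * d + e') =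
     (\<Sum>k<r. \<Sum>a<m. \<Sum>a'<m. K k b a * \<rho> $$ (a * d + e, a' * d + e') * cnj (K k b' a'))"
  using b e mult_add_less[OF b(1) e(1)] mult_add_less[OF b(2) e(2)] N
  by (simp add: tensor_id_def kraus_rep_def)

text \<open>The matrices \<open>L k\<close> are the Kraus operators tensored with the identity of
  the second system, so the output is a sum of conjugates of a positive matrix.\<close>

lemma tensor_id_psd:
  assumes "channel m n N" and R: "psd (m * d) \<rho>"
  shows "psd (n * d) (tensor_id N m n d \<rho>)"
proof -
  obtain r K where N: "kraus_rep m n N r K" using channel_kraus[OF assms(1)] .
  note Rc = psd_carrier[OF R]
  define L where "L k = mat (n * d) (m * d) (\<lambda>(q, p). if q mod d = p mod d then K k (q div d) (p div d) else 0)" for k :: nat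
  have L: "L k \<in> carrier_mat (n * d) (m * d)" for k by (simp add: L_def)
  have "tensor_id N m n d \<rho> = set_msum (n * d) (\<lambda>k. L k * \<rho> * adj (L k)) {..<r}"
  proof (rule eq_matI)
    fix p q assume "p < dim_row (set_msum (n * d) (\<lambda>k. L k * \<rho> * adj (L k)) {..<r})"
      "q < dim_col (set_msum (n * d) (\<lambda>k. L k * \<rho> * adj (L k)) {..<r})"
    then have pq: "p < n * d" "q < n * d" by (auto simp: set_msum_def)
    obtain b e where b: "b < n" "e < d" "p = b * d + e" by (rule mult_add_index[OF pq(1)])
    obtain b' e' where b': "b' < n" "e' < d" "q = b' * d + e'" by (rule mult_add_index[OF pq(2)])
    have Lp: "L k $$ (p, a * d + f) = (if f = e then K k b a else 0)" if "a < m" "f < d" for k a f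
      using that b pq mult_add_less[OF that] by (auto simp: L_def)
    have Lq: "L k $$ (q, a * d + f) = (if f = e' then K k b' a else 0)" if "a < m" "f < d" for k a f
      using that b' pq mult_add_less[OF that] by (auto simp: L_def)
    have "(L k * \<rho> * adj (L k)) $$ (p, q) =
      (\<Sum>a<m. \<Sum>a'<m. K k b a * \<rho> $$ (a * d + e, a' * d + e') * cnj (K k b' a'))" for k
    proof -
      have "(L k * \<rho> * adj (L k)) $$ (p, q) =
        (\<Sum>a<m. \<Sum>f<d. \<Sum>a'<m. \<Sum>f'<d. L k $$ (p, a * d + f) * \<rho> $$ (a * d + f, a' * d + f') * cnj (L k $$ (q, a' * d + f')))"
        unfolding conj_entry[OF L Rc pq] sum_lessThan_mult ..
      also have "\<dots> = (\<Sum>a<m. \<Sum>f<d. if f = e then (\<Sum>a'<m. \<Sum>f'<d. if f' = e' then K k b a * \<rho> $$ (a * d + f, a' * d + f') * cnj (K k b' a') else 0) else 0)"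
      proof -
        have "(\<Sum>a<m. \<Sum>f<d. \<Sum>a'<m. \<Sum>f'<d. L k $$ (p, a * d + f) * \<rho> $$ (a * d + f, a' * d + f') * cnj (L k $$ (q, a' * d + f'))) =
          (\<Sum>a<m. \<Sum>f<d. \<Sum>a'<m. \<Sum>f'<d. if f = e then if f' = e' then K k b a * \<rho> $$ (a * d + f, a' * d + f') * cnj (K k b' a') else 0 else 0)"
          by (intro sum.cong refl) (simp add: Lp Lq)
        also have "\<dots> = (\<Sum>a<m. \<Sum>f<d. if f = e then (\<Sum>a'<m. \<Sum>f'<d. if f' = e' then K k b a * \<rho> $$ (a * d + f, a' * d + f') * cnj (K k b' a') else 0) else 0)"
          by (intro sum.cong refl) simp
        finally show ?thesis .
      qed
      also have "\<dots> = (\<Sum>a<m. \<Sum>a'<m. K k b a * \<rho> $$ (a * d + e, a' * d + e') * cnj (K k b' a'))"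
        using b b' by simp
      finally show ?thesis .
    qed
    then show "tensor_id N m n d \<rho> $$ (p, q) = set_msum (n * d) (\<lambda>k. L k * \<rho> * adj (L k)) {..<r} $$ (p, q)"
      using tensor_id_entry[OF N b(1) b'(1) b(2) b'(2), of \<rho>] pq b b'
      by (simp add: set_msum_def del: index_mult_mat(1))
  qed (auto simp: set_msum_def tensor_id_def)
  moreover have "psd (n * d) (L k * \<rho> * adj (L k))" for k
    using psd_conj[OF R adj_carrier[OF L]] by simp
  ultimately show ?thesis by (simp add: psd_set_msum)
qed

text \<open>Once the sums over the Kraus index and the output index are moved innermost, trace
  preservation collapses them to a Kronecker delta.\<close>

lemma tensor_id_mtrace:
  assumes "channel m n N" and R: "\<rho> \<in> carrier_mat (m * d) (m * d)"
  shows "mtrace (tensor_id N m n d \<rho>) = mtrace \<rho>"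
proof -
  obtain r K where N: "kraus_rep m n N r K" using channel_kraus[OF assms(1)] .
  have "mtrace (tensor_id N m n d \<rho>) = (\<Sum>b<n. \<Sum>e<d. tensor_id N m n d \<rho> $$ (b * d + e, b * d + e))"
    by (simp add: mtrace_def sum_lessThan_mult carrier_matD[OF tensor_id_carrier])
  also have "\<dots> = (\<Sum>b<n. \<Sum>e<d. \<Sum>k<r. \<Sum>a<m. \<Sum>a'<m. K k b a * \<rho> $$ (a * d + e, a' * d + e) * cnj (K k b a'))"
    by (intro sum.cong refl) (simp add: tensor_id_entry[OF N])
  also have "\<dots> = (\<Sum>e<d. \<Sum>b<n. \<Sum>k<r. \<Sum>a<m. \<Sum>a'<m. K k b a * \<rho> $$ (a * d + e, a' * d + e) * cnj (K k b a'))"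
    by (rule sum.swap)
  also have "\<dots> = (\<Sum>e<d. \<Sum>a<m. \<Sum>a'<m. \<rho> $$ (a * d + e, a' * d + e) * (\<Sum>k<r. \<Sum>b<n. cnj (K k b a') * K k b a))"
  proof (rule sum.cong[OF refl])
    fix e
    let ?f = "\<lambda>b k a a'. K k b a * \<rho> $$ (a * d + e, a' * d + e) * cnj (K k b a')"
    have "(\<Sum>b<n. \<Sum>k<r. \<Sum>a<m. \<Sum>a'<m. ?f b k a a') = (\<Sum>k<r. \<Sum>b<n. \<Sum>a<m. \<Sum>a'<m. ?f b k a a')"
      by (rule sum.swap)
    also have "\<dots> = (\<Sum>k<r. \<Sum>a<m. \<Sum>b<n. \<Sum>a'<m. ?f b k a a')" by (intro sum.cong refl sum.swap)
    also have "\<dots> = (\<Sum>a<m. \<Sum>k<r. \<Sum>b<n. \<Sum>a'<m. ?f b k a a')" by (rule sum.swap)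
    also have "\<dots> = (\<Sum>a<m. \<Sum>k<r. \<Sum>a'<m. \<Sum>b<n. ?f b k a a')" by (intro sum.cong refl sum.swap)
    also have "\<dots> = (\<Sum>a<m. \<Sum>a'<m. \<Sum>k<r. \<Sum>b<n. ?f b k a a')" by (intro sum.cong refl sum.swap)
    also have "\<dots> = (\<Sum>a<m. \<Sum>a'<m. \<rho> $$ (a * d + e, a' * d + e) * (\<Sum>k<r. \<Sum>b<n. cnj (K k b a') * K k b a))"
      by (simp add: sum_distrib_left mult_ac)
    finally show "(\<Sum>b<n. \<Sum>k<r. \<Sum>a<m. \<Sum>a'<m. ?f b k a a') = \<dots>" .
  qed
  also have "\<dots> = (\<Sum>e<d. \<Sum>a<m. \<Sum>a'<m. if a' = a then \<rho> $$ (a * d + e, a * d + e) else 0)"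
    by (intro sum.cong refl) (use N in \<open>auto simp: kraus_rep_def\<close>)
  also have "\<dots> = (\<Sum>e<d. \<Sum>a<m. \<rho> $$ (a * d + e, a * d + e))" by simp
  also have "\<dots> = (\<Sum>a<m. \<Sum>e<d. \<rho> $$ (a * d + e, a * d + e))" by (rule sum.swap)
  also have "\<dots> = mtrace \<rho>" using R by (simp add: mtrace_def sum_lessThan_mult)
  finally show ?thesis .
qed

lemma proj_carrier [simp]: "v \<in> carrier_vec n \<Longrightarrow> proj v \<in> carrier_mat n n"
  by (auto simp: proj_def)

lemma proj_entry: "v \<in> carrier_vec n \<Longrightarrow> i < n \<Longrightarrow> j < n \<Longrightarrow> proj v $$ (i, j) = v $ i * cnj (v $ j)"
  by (auto simp: proj_def)

lemma proj_psd:
  assumes "v \<in> carrier_vec n"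
  shows "psd n (proj v)"
proof (rule psdI)
  fix w
  have "quad_form n (proj v) w = (\<Sum>i<n. \<Sum>j<n. (cnj (w i) * v $ i) * cnj (cnj (w j) * v $ j))"
    unfolding quad_form_def using assms by (intro sum.cong refl) (auto simp: proj_entry mult_ac)
  also have "\<dots> = (\<Sum>i<n. cnj (w i) * v $ i) * cnj (\<Sum>i<n. cnj (w i) * v $ i)"
    by (simp add: sum_product)
  also have "\<dots> = of_real ((cmod (\<Sum>i<n. cnj (w i) * v $ i))\<^sup>2)" by (simp only: complex_norm_square)
  finally show "\<exists>r\<ge>0. quad_form n (proj v) w = complex_of_real r" by (metis zero_le_power2)
qed (use assms in simp)

lemma proj_mtrace: "unit_state n v \<Longrightarrow> mtrace (proj v) = 1"
proof -
  assume v: "unit_state n v"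
  have "mtrace (proj v) = (\<Sum>i<n. of_real ((cmod (v $ i))\<^sup>2))"
    unfolding mtrace_def by (intro sum.cong) (use v in \<open>auto simp: unit_state_def proj_def complex_norm_square simp del: of_real_power\<close>)
  also have "\<dots> = of_real (\<Sum>i<n. (cmod (v $ i))\<^sup>2)" by simp
  also have "(\<Sum>i<n. (cmod (v $ i))\<^sup>2) = 1" using v by (simp add: unit_state_def)
  finally show ?thesis by simp
qed


section \<open>Registers indexed by positions\<close>

lemma msum_map: "msum n f (map g xs) = msum n (\<lambda>x. f (g x)) xs"
  by (induction xs) (auto simp: msum_def)

text \<open>A computational basis state of a family of \<open>d\<close>-dimensional systems indexed by \<open>X\<close> is a
  function \<open>X \<rightarrow>\<^sub>E {..<d}\<close>; the bijection \<open>h\<close> numbers these functions by \<open>{..<E}\<close>.\<close>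

locale registers =
  fixes X :: "'x set" and d E :: nat and h :: "nat \<Rightarrow> 'x \<Rightarrow> nat"
  assumes finite_X: "finite X" and d_pos: "0 < d" and h_bij: "bij_betw h {..<E} (X \<rightarrow>\<^sub>E {..<d})"
begin

definition rest :: "'x \<Rightarrow> ('x \<Rightarrow> nat) set" where
  "rest x = (X - {x}) \<rightarrow>\<^sub>E {..<d}"

text \<open>Splits off register \<open>x\<close>: through \<open>put_bij\<close> the pair of a
  configuration \<open>r\<close> of the other registers and a value \<open>a\<close> serves as a
  product index for the basis of the whole family.\<close>

definition put :: "'x \<Rightarrow> ('x \<Rightarrow> nat) \<Rightarrow> nat \<Rightarrow> nat" where
  "put x r a = inv_into {..<E} h (r(x := a))"

lemma finite_rest [simp]: "finite (rest x)"
  using finite_X by (auto simp: rest_def intro!: finite_PiE)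

lemma h_less: "g < E \<Longrightarrow> y \<in> X \<Longrightarrow> h g y < d"
  using bij_betwE[OF h_bij] by (auto simp: PiE_iff)

lemma fun_upd_config: "x \<in> X \<Longrightarrow> r \<in> rest x \<Longrightarrow> a < d \<Longrightarrow> r(x := a) \<in> X \<rightarrow>\<^sub>E {..<d}"
  using PiE_fun_upd[of a "\<lambda>_. {..<d}" x r "X - {x}"] by (auto simp: rest_def insert_absorb)

lemma put_less: "x \<in> X \<Longrightarrow> r \<in> rest x \<Longrightarrow> a < d \<Longrightarrow> put x r a < E"
  using inv_into_into[of "r(x := a)" h "{..<E}"] fun_upd_config[of x r a] h_bij
  by (auto simp: put_def bij_betw_def)

lemma h_put: "x \<in> X \<Longrightarrow> r \<in> rest x \<Longrightarrow> a < d \<Longrightarrow> h (put x r a) = r(x := a)"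
  using fun_upd_config[of x r a] h_bij by (auto simp: put_def bij_betw_def f_inv_into_f)

lemma rest_undefined: "r \<in> rest x \<Longrightarrow> r x = undefined"
  by (auto simp: rest_def PiE_def extensional_def)

lemma put_eq_iff:
  assumes "x \<in> X" "r \<in> rest x" "r' \<in> rest x" "a < d" "a' < d"
  shows "put x r a = put x r' a' \<longleftrightarrow> r = r' \<and> a = a'"
proof
  assume "put x r a = put x r' a'"
  then have e: "r(x := a) = r'(x := a')" using h_put assms by metis
  then have "r = r'" using rest_undefined[OF assms(2)] rest_undefined[OF assms(3)]
    by (metis fun_upd_idem fun_upd_upd)
  with e show "r = r' \<and> a = a'" by (metis fun_upd_same)
qed simp

lemma put_bij:
  assumes "x \<in> X"
  shows "bij_betw (\<lambda>(r, a). put x r a) (rest x \<times> {..<d}) {..<E}"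
proof (rule bij_betwI')
  fix p q assume "p \<in> rest x \<times> {..<d}" "q \<in> rest x \<times> {..<d}"
  then show "((\<lambda>(r, a). put x r a) p = (\<lambda>(r, a). put x r a) q) = (p = q)"
    using put_eq_iff[OF assms] by auto
next
  fix p assume "p \<in> rest x \<times> {..<d}"
  then show "(\<lambda>(r, a). put x r a) p \<in> {..<E}" using put_less[OF assms] by auto
next
  fix g assume g: "g \<in> {..<E}"
  have hg: "h g \<in> X \<rightarrow>\<^sub>E {..<d}" using bij_betwE[OF h_bij] g by blast
  have r: "(h g)(x := undefined) \<in> rest x"
    using fun_upd_in_PiE[of x "X - {x}" "h g" "\<lambda>_. {..<d}"] hg assms by (auto simp: rest_def insert_absorb)
  have "put x ((h g)(x := undefined)) (h g x) = inv_into {..<E} h (h g)" by (simp add: put_def)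
  also have "\<dots> = g" using h_bij g by (auto simp: bij_betw_def intro!: inv_into_f_f)
  finally show "\<exists>p\<in>rest x \<times> {..<d}. g = (\<lambda>(r, a). put x r a) p"
    using r h_less[of g x] g assms by (intro bexI[of _ "((h g)(x := undefined), h g x)"]) auto
qed

lemma sum_put:
  fixes F :: "nat \<Rightarrow> 'a :: comm_monoid_add"
  assumes "x \<in> X"
  shows "(\<Sum>g<E. F g) = (\<Sum>r\<in>rest x. \<Sum>a<d. F (put x r a))"
  using sum.reindex_bij_betw[OF put_bij[OF assms], of F]
  by (simp add: sum.cartesian_product case_prod_unfold)

lemma put_cases:
  assumes "g < E" "x \<in> X"
  obtains r a where "r \<in> rest x" "a < d" "g = put x r a"
  using bij_betw_imp_surj_on[OF put_bij[OF assms(2)]] assms(1) that by (auto simp: image_iff set_eq_iff) 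

lemma sum_h:
  fixes F :: "('x \<Rightarrow> nat) \<Rightarrow> 'a :: comm_monoid_add"
  shows "(\<Sum>g<E. F (h g)) = (\<Sum>G\<in>X \<rightarrow>\<^sub>E {..<d}. F G)"
  by (rule sum.reindex_bij_betw[OF h_bij])

lemma E_pos: "0 < E"
proof -
  have "(\<lambda>y\<in>X. 0) \<in> X \<rightarrow>\<^sub>E {..<d}" using d_pos by auto
  then have "X \<rightarrow>\<^sub>E {..<d} \<noteq> {}" by blast
  then show ?thesis using h_bij by (cases "E = 0") (auto simp: bij_betw_def)
qed

text \<open>Distributivity over configurations; this is how partial traces of product states factor
  register by register.\<close>

lemma sum_rest_prod:
  fixes f :: "'x \<Rightarrow> nat \<Rightarrow> complex"
  shows "(\<Sum>r\<in>rest x. \<Prod>y\<in>X - {x}. f y (r y)) = (\<Prod>y\<in>X - {x}. \<Sum>c<d. f y c)"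
  unfolding rest_def by (rule prod_sum_PiE[symmetric]) (use finite_X in auto)

subsection \<open>Discarding all registers but one\<close>

text \<open>Kraus operators of the partial trace onto register \<open>x\<close>: each applies the
  bra of one configuration \<open>r\<close> to the other registers.\<close>

definition discard_op :: "'x \<Rightarrow> ('x \<Rightarrow> nat) \<Rightarrow> complex mat" where
  "discard_op x r = mat d E (\<lambda>(a, f). if f = put x r a then 1 else 0)"

text \<open>Channels are defined with lists of Kraus operators, so some enumeration of the
  configurations is fixed.\<close>

definition rest_list :: "'x \<Rightarrow> ('x \<Rightarrow> nat) list" where
  "rest_list x = (SOME rs. set rs = rest x \<and> distinct rs)"

definition discard :: "'x \<Rightarrow> complex mat \<Rightarrow> complex mat" where
  "discard x Z = msum d (\<lambda>r. discard_op x r * Z * adj (discard_op x r)) (rest_list x)"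

lemma rest_list: "set (rest_list x) = rest x" "distinct (rest_list x)"
  using someI_ex[OF finite_distinct_list[OF finite_rest[of x]]] by (auto simp: rest_list_def)

lemma discard_op_carrier [simp]: "discard_op x r \<in> carrier_mat d E"
  by (simp add: discard_op_def)

text \<open>Every basis index is \<open>put x r a\<close> for exactly one pair of \<open>r\<close>
  and \<open>a\<close>, which gives the completeness relation.\<close>

lemma discard_channel:
  assumes x: "x \<in> X"
  shows "channel E d (discard x)"
  unfolding channel_def
proof (intro exI conjI ballI)
  let ?Ks = "map (discard_op x) (rest_list x)"
  show "set ?Ks \<subseteq> carrier_mat d E" by auto
  show "discard x Z = msum d (\<lambda>K. K * Z * adj K) ?Ks" for Z by (simp add: discard_def msum_map)
  have "msum E (\<lambda>K. adj K * K) ?Ks = set_msum E (\<lambda>r. adj (discard_op x r) * discard_op x r) (rest x)"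
    unfolding msum_map by (subst msum_eq_set_msum) (auto simp: rest_list mult_carrier_mat[of _ E d _ E])
  also have "\<dots> = 1\<^sub>m E"
  proof (rule eq_matI)
    fix f f' assume "f < dim_row (1\<^sub>m E :: complex mat)" "f' < dim_col (1\<^sub>m E :: complex mat)"
    then have f: "f < E" "f' < E" by auto
    have "set_msum E (\<lambda>r. adj (discard_op x r) * discard_op x r) (rest x) $$ (f, f')
      = (\<Sum>r\<in>rest x. \<Sum>a<d. (\<lambda>g. if g = f then if f' = g then 1 else 0 else 0) (put x r a))"
      using f
      by (simp add: set_msum_def mult_mat_entry[OF adj_carrier[OF discard_op_carrier] discard_op_carrier]
          adj_entry[OF discard_op_carrier] del: index_mult_mat(1))
        (intro sum.cong refl, auto simp: discard_op_def)
    also have "\<dots> = (\<Sum>g<E. if g = f then if f' = g then 1 else 0 else 0)" by (rule sum_put[OF x, symmetric])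
    also have "\<dots> = 1\<^sub>m E $$ (f, f')" using f by auto
    finally show "set_msum E (\<lambda>r. adj (discard_op x r) * discard_op x r) (rest x) $$ (f, f') = 1\<^sub>m E $$ (f, f')" .
  qed (auto simp: set_msum_def)
  finally show "msum E (\<lambda>K. adj K * K) ?Ks = 1\<^sub>m E" .
qed

lemma discard_entry:
  assumes x: "x \<in> X" and Z: "Z \<in> carrier_mat E E" and a: "a < d" "a' < d"
  shows "discard x Z $$ (a, a') = (\<Sum>r\<in>rest x. Z $$ (put x r a, put x r a'))"
proof -
  have "discard x Z = set_msum d (\<lambda>r. discard_op x r * Z * adj (discard_op x r)) (rest x)"
    unfolding discard_def using Z
    by (subst msum_eq_set_msum) (auto simp: rest_list mult_carrier_mat[of _ d E _ E] mult_carrier_mat[of _ d E _ d])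
  then have "discard x Z $$ (a, a') = (\<Sum>r\<in>rest x. (discard_op x r * Z * adj (discard_op x r)) $$ (a, a'))"
    using a by (simp add: set_msum_def)
  also have "\<dots> = (\<Sum>r\<in>rest x. Z $$ (put x r a, put x r a'))"
  proof (rule sum.cong[OF refl])
    fix r assume r: "r \<in> rest x"
    have "(discard_op x r * Z * adj (discard_op x r)) $$ (a, a')
      = (\<Sum>f<E. \<Sum>f'<E. if f = put x r a then if f' = put x r a' then Z $$ (f, f') else 0 else 0)"
      unfolding conj_entry[OF discard_op_carrier Z a]
      by (intro sum.cong refl) (use a in \<open>auto simp: discard_op_def\<close>)
    also have "\<dots> = (\<Sum>f<E. if f = put x r a then \<Sum>f'<E. if f' = put x r a' then Z $$ (f, f') else 0 else 0)"
      by (intro sum.cong refl) simp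
    also have "\<dots> = Z $$ (put x r a, put x r a')" using put_less[OF x r a(1)] put_less[OF x r a(2)] by simp
    finally show "(discard_op x r * Z * adj (discard_op x r)) $$ (a, a') = Z $$ (put x r a, put x r a')" .
  qed
  finally show ?thesis .
qed

subsection \<open>Operators acting on one register\<close>

definition embed_index :: "'x \<Rightarrow> ('x \<Rightarrow> nat) \<Rightarrow> nat \<Rightarrow> nat" where
  "embed_index x r p = (p div d) * E + put x r (p mod d)"

text \<open>The operator \<open>L\<close> on the \<open>n\<close>-dimensional system and register
  \<open>x\<close>, tensored with the identity on the other registers; the condition on
  \<open>h\<close> is the Kronecker delta of that identity.\<close>

definition lift_op :: "nat \<Rightarrow> 'x \<Rightarrow> complex mat \<Rightarrow> complex mat" where
  "lift_op n x L = mat (n * E) (n * E) (\<lambda>(p, q).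
     if \<forall>y\<in>X - {x}. h (p mod E) y = h (q mod E) y
     then L $$ ((p div E) * d + h (p mod E) x, (q div E) * d + h (q mod E) x) else 0)"

lemma lift_op_carrier [simp]: "lift_op n x L \<in> carrier_mat (n * E) (n * E)"
  by (simp add: lift_op_def)

lemma lift_op_entry:
  assumes x: "x \<in> X" and b: "b < n" "b' < n" and r: "r \<in> rest x" "r' \<in> rest x" and a: "a < d" "a' < d"
  shows "lift_op n x L $$ (b * E + put x r a, b' * E + put x r' a') =
    (if r = r' then L $$ (b * d + a, b' * d + a') else 0)"
proof -
  have g: "put x r a < E" "put x r' a' < E" using put_less x r a by auto
  have "(\<forall>y\<in>X - {x}. h (put x r a) y = h (put x r' a') y) \<longleftrightarrow> r = r'"
  proof
    assume "\<forall>y\<in>X - {x}. h (put x r a) y = h (put x r' a') y"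
    then have "\<And>y. y \<in> X - {x} \<Longrightarrow> r y = r' y" using h_put[OF x r(1) a(1)] h_put[OF x r(2) a(2)] by simp
    then show "r = r'" using r unfolding rest_def by (rule PiE_ext[rotated 2])
  qed (use h_put[OF x r(1) a(1)] h_put[OF x r(2) a(2)] in simp)
  moreover have "(b * E + put x r a) mod E = put x r a" "(b' * E + put x r' a') mod E = put x r' a'"
    "(b * E + put x r a) div E = b" "(b' * E + put x r' a') div E = b'" using g by auto
  moreover have "h (put x r a) x = a" "h (put x r' a') x = a'"
    using h_put[OF x r(1) a(1)] h_put[OF x r(2) a(2)] by auto
  ultimately show ?thesis
    unfolding lift_op_def using mult_add_less[OF b(1) g(1)] mult_add_less[OF b(2) g(2)]
    by (simp only: index_mat case_prod_conv)
qed

text \<open>Up to reindexing by \<open>embed_index\<close>, a lifted operator is block diagonal with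
  one copy of \<open>L\<close> for each configuration of the other registers. Positivity and traces
  thereby reduce to \<open>L\<close>.\<close>

lemma sum_lift_op:
  assumes x: "x \<in> X"
  shows "(\<Sum>p<n * E. \<Sum>q<n * E. lift_op n x L $$ (p, q) * F p q) =
    (\<Sum>r\<in>rest x. \<Sum>p<n * d. \<Sum>q<n * d. L $$ (p, q) * F (embed_index x r p) (embed_index x r q))"
proof -
  let ?t = "\<lambda>b r a b' a'. L $$ (b * d + a, b' * d + a') * F (b * E + put x r a) (b' * E + put x r a')"
  have "(\<Sum>p<n * E. \<Sum>q<n * E. lift_op n x L $$ (p, q) * F p q) =
    (\<Sum>b<n. \<Sum>r\<in>rest x. \<Sum>a<d. \<Sum>b'<n. \<Sum>r'\<in>rest x. \<Sum>a'<d.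
      lift_op n x L $$ (b * E + put x r a, b' * E + put x r' a') * F (b * E + put x r a) (b' * E + put x r' a'))"
    unfolding sum_lessThan_mult sum_put[OF x] ..
  also have "\<dots> = (\<Sum>b<n. \<Sum>r\<in>rest x. \<Sum>a<d. \<Sum>b'<n. \<Sum>r'\<in>rest x. if r' = r then \<Sum>a'<d. ?t b r a b' a' else 0)"
    by (intro sum.cong refl) (auto simp: lift_op_entry[OF x])
  also have "\<dots> = (\<Sum>b<n. \<Sum>r\<in>rest x. \<Sum>a<d. \<Sum>b'<n. \<Sum>a'<d. ?t b r a b' a')"
    by (intro sum.cong refl) simp
  also have "\<dots> = (\<Sum>r\<in>rest x. \<Sum>b<n. \<Sum>a<d. \<Sum>b'<n. \<Sum>a'<d. ?t b r a b' a')" by (rule sum.swap)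
  also have "\<dots> = (\<Sum>r\<in>rest x. \<Sum>p<n * d. \<Sum>q<n * d. L $$ (p, q) * F (embed_index x r p) (embed_index x r q))"
    unfolding sum_lessThan_mult by (intro sum.cong refl) (simp add: embed_index_def)
  finally show ?thesis .
qed

lemma lift_op_psd:
  assumes x: "x \<in> X" and L: "psd (n * d) L"
  shows "psd (n * E) (lift_op n x L)"
proof -
  have "quad_form (n * E) (lift_op n x L) v = (\<Sum>r\<in>rest x. quad_form (n * d) L (\<lambda>p. v (embed_index x r p)))" for v
    using sum_lift_op[OF x, of n L "\<lambda>p q. cnj (v p) * v q"] by (simp add: quad_form_def mult_ac)
  then show ?thesis using psdD[OF L] by (auto simp: psd_iff_quad_form intro!: sum_nonneg)
qed

lemma lift_op_one:
  assumes x: "x \<in> X"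
  shows "lift_op n x (1\<^sub>m (n * d)) = 1\<^sub>m (n * E)"
proof (rule eq_matI)
  fix p q assume "p < dim_row (1\<^sub>m (n * E) :: complex mat)" "q < dim_col (1\<^sub>m (n * E) :: complex mat)"
  then have pq: "p < n * E" "q < n * E" by auto
  obtain b g where b: "b < n" "g < E" "p = b * E + g" by (rule mult_add_index[OF pq(1)])
  obtain b' g' where b': "b' < n" "g' < E" "q = b' * E + g'" by (rule mult_add_index[OF pq(2)])
  obtain r a where r: "r \<in> rest x" "a < d" "g = put x r a" by (rule put_cases[OF b(2) x])
  obtain r' a' where r': "r' \<in> rest x" "a' < d" "g' = put x r' a'" by (rule put_cases[OF b'(2) x])
  have inj: "b * m + e = b' * m + e' \<longleftrightarrow> b = b' \<and> e = e'" if "e < m" "e' < m" for e e' m :: nat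
    using that by (metis add.commute div_mult_self3 div_less add_0 mod_mult_self3 mod_less mult.commute not_less_zero)
  have "p = q \<longleftrightarrow> b = b' \<and> r = r' \<and> a = a'"
    using inj[OF b(2) b'(2)] put_eq_iff[OF x r(1) r'(1) r(2) r'(2)] b(3) b'(3) r(3) r'(3) by simp
  moreover have "b * d + a = b' * d + a' \<longleftrightarrow> b = b' \<and> a = a'" by (rule inj[OF r(2) r'(2)])
  ultimately show "lift_op n x (1\<^sub>m (n * d)) $$ (p, q) = 1\<^sub>m (n * E) $$ (p, q)"
    using lift_op_entry[OF x b(1) b'(1) r(1) r'(1) r(2) r'(2), of "1\<^sub>m (n * d)"] pq
      mult_add_less[OF b(1) r(2)] mult_add_less[OF b'(1) r'(2)]
    by (simp add: b(3) b'(3) r(3) r'(3))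
qed (auto simp: lift_op_def)

lemma lift_op_minus:
  assumes x: "x \<in> X" and A: "A \<in> carrier_mat (n * d) (n * d)" and B: "B \<in> carrier_mat (n * d) (n * d)"
  shows "lift_op n x (A - B) = lift_op n x A - lift_op n x B"
proof (rule eq_matI)
  fix p q assume "p < dim_row (lift_op n x A - lift_op n x B)" "q < dim_col (lift_op n x A - lift_op n x B)"
  then have pq: "p < n * E" "q < n * E" by (auto simp: lift_op_def)
  have "(p div E) * d + h (p mod E) x < n * d" "(q div E) * d + h (q mod E) x < n * d"
    using pq E_pos x by (auto intro!: mult_add_less h_less simp: less_mult_imp_div_less)
  then show "lift_op n x (A - B) $$ (p, q) = (lift_op n x A - lift_op n x B) $$ (p, q)"
    using pq A B by (simp add: lift_op_def)
qed (auto simp: lift_op_def)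

lemma lift_op_effect:
  assumes x: "x \<in> X" and L: "effect (n * d) L"
  shows "effect (n * E) (lift_op n x L)"
proof -
  have "psd (n * d) L" "psd (n * d) (1\<^sub>m (n * d) - L)" using L by (auto simp: effect_def)
  from this[THEN lift_op_psd[OF x]] show ?thesis
    using lift_op_minus[OF x one_carrier_mat psd_carrier[OF \<open>psd (n * d) L\<close>]]
    by (simp add: effect_def lift_op_one[OF x])
qed

text \<open>The partial trace over all registers except \<open>x\<close>, dual to
  \<open>lift_op\<close> under the trace pairing.\<close>

definition reduced :: "nat \<Rightarrow> 'x \<Rightarrow> complex mat \<Rightarrow> complex mat" where
  "reduced n x W = mat (n * d) (n * d) (\<lambda>(p, q). \<Sum>r\<in>rest x. W $$ (embed_index x r p, embed_index x r q))"

lemma mtrace_lift_op: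
  assumes x: "x \<in> X" and L: "L \<in> carrier_mat (n * d) (n * d)" and W: "W \<in> carrier_mat (n * E) (n * E)"
  shows "mtrace (lift_op n x L * W) = mtrace (L * reduced n x W)"
proof -
  have R: "reduced n x W \<in> carrier_mat (n * d) (n * d)" by (simp add: reduced_def)
  have "mtrace (lift_op n x L * W) =
    (\<Sum>r\<in>rest x. \<Sum>p<n * d. \<Sum>q<n * d. L $$ (p, q) * W $$ (embed_index x r q, embed_index x r p))"
    unfolding mtrace_mult[OF lift_op_carrier W] sum_lift_op[OF x, of n L "\<lambda>p q. W $$ (q, p)"] ..
  also have "\<dots> = (\<Sum>p<n * d. \<Sum>r\<in>rest x. \<Sum>q<n * d. L $$ (p, q) * W $$ (embed_index x r q, embed_index x r p))"
    by (rule sum.swap)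
  also have "\<dots> = (\<Sum>p<n * d. \<Sum>q<n * d. \<Sum>r\<in>rest x. L $$ (p, q) * W $$ (embed_index x r q, embed_index x r p))"
    by (intro sum.cong refl sum.swap)
  also have "\<dots> = mtrace (L * reduced n x W)"
    unfolding mtrace_mult[OF L R] by (intro sum.cong refl) (simp add: reduced_def sum_distrib_left)
  finally show ?thesis .
qed

end


section \<open>Marginals of a channel output\<close>

text \<open>Entries of the partial trace of the pure state \<open>v\<close> over the channel input.
  The received states contain products of these numbers over registers.\<close>

definition reference_kernel :: "nat \<Rightarrow> complex vec \<Rightarrow> nat \<Rightarrow> nat \<Rightarrow> complex" where
  "reference_kernel d v c c' = (\<Sum>a<d. v $ (a * d + c) * cnj (v $ (a * d + c')))"

definition reference_marginal :: "nat \<Rightarrow> complex vec \<Rightarrow> complex mat" where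
  "reference_marginal d v = mat d d (\<lambda>(c, c'). reference_kernel d v c c')"

definition channel_output :: "(complex mat \<Rightarrow> complex mat) \<Rightarrow> nat \<Rightarrow> nat \<Rightarrow> complex vec \<Rightarrow> complex mat" where
  "channel_output N d n v = tensor_id N d n d (proj v)"

definition output_marginal :: "(complex mat \<Rightarrow> complex mat) \<Rightarrow> nat \<Rightarrow> nat \<Rightarrow> complex vec \<Rightarrow> complex mat" where
  "output_marginal N d n v = mat n n (\<lambda>(b, b'). \<Sum>c<d. channel_output N d n v $$ (b * d + c, b' * d + c))"

lemma channel_output_carrier [simp]: "channel_output N d n v \<in> carrier_mat (n * d) (n * d)"
  by (simp add: channel_output_def)

lemma reference_kernel_trace:
  assumes "unit_state (d * d) v"
  shows "(\<Sum>c<d. reference_kernel d v c c) = 1"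
proof -
  have "(\<Sum>c<d. reference_kernel d v c c) = (\<Sum>a<d. \<Sum>c<d. v $ (a * d + c) * cnj (v $ (a * d + c)))"
    unfolding reference_kernel_def by (rule sum.swap)
  also have "\<dots> = (\<Sum>p<d * d. complex_of_real ((cmod (v $ p))\<^sup>2))"
    unfolding sum_lessThan_mult complex_norm_square ..
  also have "\<dots> = complex_of_real (\<Sum>p<d * d. (cmod (v $ p))\<^sup>2)" by (rule of_real_sum[symmetric])
  also have "(\<Sum>p<d * d. (cmod (v $ p))\<^sup>2) = 1" using assms by (simp add: unit_state_def)
  finally show ?thesis by simp
qed

lemma reference_marginal_density:
  assumes "unit_state (d * d) v"
  shows "density d (reference_marginal d v)"
proof -
  \<comment> \<open>With \<open>v\<close> arranged as a square array, each row contributes an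
    unnormalised rank-one matrix.\<close>
  have "reference_marginal d v = set_msum d (\<lambda>a. proj (vec d (\<lambda>c. v $ (a * d + c)))) {..<d}"
    by (rule eq_matI) (auto simp: reference_marginal_def reference_kernel_def set_msum_def proj_def)
  then have "psd d (reference_marginal d v)" by (auto intro!: psd_set_msum proj_psd)
  moreover have "mtrace (reference_marginal d v) = 1"
    using reference_kernel_trace[OF assms] by (simp add: mtrace_def reference_marginal_def)
  ultimately show ?thesis by (simp add: density_def)
qed

lemma output_marginal_density:
  assumes v: "unit_state (d * d) v" and N: "channel d n N"
  shows "density n (output_marginal N d n v)"
proof -
  define W where "W = channel_output N d n v"
  have vc: "v \<in> carrier_vec (d * d)" using v by (simp add: unit_state_def)
  have W: "psd (n * d) W"
    unfolding W_def channel_output_def by (rule tensor_id_psd[OF N proj_psd[OF vc]])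
  have M: "output_marginal N d n v = mat n n (\<lambda>(b, b'). \<Sum>c<d. W $$ (b * d + c, b' * d + c))"
    by (simp add: output_marginal_def W_def)
  \<comment> \<open>\<open>?w u c\<close> is the product of \<open>u\<close> with the basis vector
    numbered \<open>c\<close> of the reference; summing the quadratic form over \<open>c\<close>
    gives that of the partial trace.\<close>
  let ?w = "\<lambda>v c p. if p mod d = c then v (p div d) else 0"
  have "quad_form n (output_marginal N d n v) u = (\<Sum>c<d. quad_form (n * d) W (?w u c))" for u
  proof -
    have "quad_form (n * d) W (?w u c) = (\<Sum>b<n. \<Sum>b'<n. cnj (u b) * W $$ (b * d + c, b' * d + c) * u b')"
      if c: "c < d" for c
    proof -
      have "quad_form (n * d) W (?w u c) = (\<Sum>b<n. \<Sum>e<d. \<Sum>b'<n. \<Sum>e'<d.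
        if e = c then if e' = c then cnj (u b) * W $$ (b * d + e, b' * d + e') * u b' else 0 else 0)"
        unfolding quad_form_def sum_lessThan_mult by (intro sum.cong refl) auto
      also have "\<dots> = (\<Sum>b<n. \<Sum>e<d. if e = c then \<Sum>b'<n. \<Sum>e'<d.
        if e' = c then cnj (u b) * W $$ (b * d + e, b' * d + e') * u b' else 0 else 0)"
        by (intro sum.cong refl) simp
      finally show ?thesis using c by simp
    qed
    then have "(\<Sum>c<d. quad_form (n * d) W (?w u c)) =
      (\<Sum>c<d. \<Sum>b<n. \<Sum>b'<n. cnj (u b) * W $$ (b * d + c, b' * d + c) * u b')" by simp
    also have "\<dots> = (\<Sum>b<n. \<Sum>c<d. \<Sum>b'<n. cnj (u b) * W $$ (b * d + c, b' * d + c) * u b')" by (rule sum.swap)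
    also have "\<dots> = (\<Sum>b<n. \<Sum>b'<n. \<Sum>c<d. cnj (u b) * W $$ (b * d + c, b' * d + c) * u b')"
      by (intro sum.cong refl sum.swap)
    also have "\<dots> = quad_form n (output_marginal N d n v) u"
      unfolding quad_form_def by (intro sum.cong refl) (simp add: M sum_distrib_left sum_distrib_right)
    finally show ?thesis by simp
  qed
  then have "psd n (output_marginal N d n v)"
    using psdD[OF W] by (auto simp: psd_iff_quad_form M intro!: sum_nonneg)
  moreover have "mtrace (output_marginal N d n v) = mtrace W"
    using psd_carrier[OF W] by (simp add: mtrace_def M sum_lessThan_mult)
  moreover have "mtrace W = 1"
    unfolding W_def channel_output_def using tensor_id_mtrace[OF N proj_carrier[OF vc]] proj_mtrace[OF v] by simp
  ultimately show ?thesis by (simp add: density_def)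
qed

section \<open>Position-based coding\<close>

locale position_coding = registers X d E h
  for X :: "'x set" and d E :: nat and h :: "nat \<Rightarrow> 'x \<Rightarrow> nat" +
  fixes psi :: "'x \<Rightarrow> complex vec"
  assumes psi: "\<And>x. x \<in> X \<Longrightarrow> unit_state (d * d) (psi x)"
begin

text \<open>The tensor product of the states \<open>psi y\<close>, regrouped so that all
  channel-input halves form the first factor and all reference halves the second.\<close>

definition shared :: "complex vec" where
  "shared = vec (E * E) (\<lambda>p. \<Prod>y\<in>X. psi y $ (h (p div E) y * d + h (p mod E) y))"

definition received :: "(complex mat \<Rightarrow> complex mat) \<Rightarrow> nat \<Rightarrow> 'x \<Rightarrow> complex mat" where
  "received N n x = tensor_id N d n E (tensor_id (discard x) E d E (proj shared))"

lemma shared_carrier [simp]: "shared \<in> carrier_vec (E * E)"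
  by (simp add: shared_def)

lemma shared_entry:
  "f < E \<Longrightarrow> g < E \<Longrightarrow> shared $ (f * E + g) = (\<Prod>y\<in>X. psi y $ (h f y * d + h g y))"
  using mult_add_less[of f E g E] by (simp add: shared_def)

lemma shared_unit: "unit_state (E * E) shared"
proof -
  let ?q = "\<lambda>y a c. (cmod (psi y $ (a * d + c)))\<^sup>2"
  have "(\<Sum>p<E * E. (cmod (shared $ p))\<^sup>2) = (\<Sum>f<E. \<Sum>g<E. \<Prod>y\<in>X. ?q y (h f y) (h g y))"
    unfolding sum_lessThan_mult
    by (intro sum.cong refl) (simp add: shared_entry prod_norm[symmetric] prod_power_distrib)
  also have "\<dots> = (\<Sum>f<E. \<Sum>G\<in>X \<rightarrow>\<^sub>E {..<d}. \<Prod>y\<in>X. ?q y (h f y) (G y))"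
    by (intro sum.cong refl sum_h)
  also have "\<dots> = (\<Sum>F\<in>X \<rightarrow>\<^sub>E {..<d}. \<Sum>G\<in>X \<rightarrow>\<^sub>E {..<d}. \<Prod>y\<in>X. ?q y (F y) (G y))"
    by (rule sum_h)
  also have "\<dots> = (\<Sum>F\<in>X \<rightarrow>\<^sub>E {..<d}. \<Prod>y\<in>X. \<Sum>c<d. ?q y (F y) c)"
    by (intro sum.cong refl prod_sum_PiE[symmetric]) (use finite_X in auto)
  also have "\<dots> = (\<Prod>y\<in>X. \<Sum>a<d. \<Sum>c<d. ?q y a c)"
    by (intro prod_sum_PiE[symmetric]) (use finite_X in auto)
  also have "\<dots> = 1"
    using psi by (intro prod.neutral) (auto simp: unit_state_def sum_lessThan_mult)
  finally show ?thesis by (simp add: unit_state_def)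
qed

text \<open>Discarding Alice's other halves leaves \<open>psi x\<close> intact and reduces every
  other copy to its reference marginal.\<close>

lemma encoded_entry:
  assumes x: "x \<in> X" and a: "a < d" "a' < d" and g: "g < E" "g' < E"
  shows "tensor_id (discard x) E d E (proj shared) $$ (a * E + g, a' * E + g') =
    psi x $ (a * d + h g x) * cnj (psi x $ (a' * d + h g' x)) *
    (\<Prod>y\<in>X - {x}. reference_kernel d (psi y) (h g y) (h g' y))"
proof -
  have s: "shared $ (put x r b * E + k) = psi x $ (b * d + h k x) * (\<Prod>y\<in>X - {x}. psi y $ (r y * d + h k y))"
    if "r \<in> rest x" "b < d" "k < E" for r b k
    unfolding shared_entry[OF put_less[OF x that(1,2)] that(3)] prod.remove[OF finite_X x] h_put[OF x that(1,2)]
    by simp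
  have "tensor_id (discard x) E d E (proj shared) $$ (a * E + g, a' * E + g') =
    discard x (mat E E (\<lambda>(f, f'). proj shared $$ (f * E + g, f' * E + g'))) $$ (a, a')"
    using a g mult_add_less[OF a(1) g(1)] mult_add_less[OF a(2) g(2)] by (simp add: tensor_id_def)
  also have "\<dots> = (\<Sum>r\<in>rest x. proj shared $$ (put x r a * E + g, put x r a' * E + g'))"
    by (subst discard_entry[OF x _ a]) (auto intro!: sum.cong simp: put_less[OF x] a)
  also have "\<dots> = (\<Sum>r\<in>rest x. psi x $ (a * d + h g x) * cnj (psi x $ (a' * d + h g' x)) *
      (\<Prod>y\<in>X - {x}. psi y $ (r y * d + h g y) * cnj (psi y $ (r y * d + h g' y))))"
  proof (rule sum.cong[OF refl])
    fix r assume r: "r \<in> rest x"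
    have "proj shared $$ (put x r a * E + g, put x r a' * E + g') =
      shared $ (put x r a * E + g) * cnj (shared $ (put x r a' * E + g'))"
      by (rule proj_entry[OF shared_carrier]) (use put_less[OF x r] a g mult_add_less in auto)
    then show "proj shared $$ (put x r a * E + g, put x r a' * E + g') =
      psi x $ (a * d + h g x) * cnj (psi x $ (a' * d + h g' x)) *
      (\<Prod>y\<in>X - {x}. psi y $ (r y * d + h g y) * cnj (psi y $ (r y * d + h g' y)))"
      by (simp add: s r a g prod.distrib)
  qed
  also have "\<dots> = psi x $ (a * d + h g x) * cnj (psi x $ (a' * d + h g' x)) *
      (\<Sum>r\<in>rest x. \<Prod>y\<in>X - {x}. psi y $ (r y * d + h g y) * cnj (psi y $ (r y * d + h g' y)))"
    by (rule sum_distrib_left[symmetric])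
  also have "(\<Sum>r\<in>rest x. \<Prod>y\<in>X - {x}. psi y $ (r y * d + h g y) * cnj (psi y $ (r y * d + h g' y))) =
    (\<Prod>y\<in>X - {x}. reference_kernel d (psi y) (h g y) (h g' y))"
    unfolding reference_kernel_def
    by (rule sum_rest_prod[where f = "\<lambda>y c. psi y $ (c * d + h g y) * cnj (psi y $ (c * d + h g' y))"])
  finally show ?thesis .
qed

text \<open>The channel acts on Alice's half of copy \<open>x\<close> only, so the factors of the
  other copies pass through its Kraus sum as scalars.\<close>

lemma received_entry:
  assumes x: "x \<in> X" and N: "channel d n N" and b: "b < n" "b' < n" and g: "g < E" "g' < E"
  shows "received N n x $$ (b * E + g, b' * E + g') =
    channel_output N d n (psi x) $$ (b * d + h g x, b' * d + h g' x) *
    (\<Prod>y\<in>X - {x}. reference_kernel d (psi y) (h g y) (h g' y))"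
proof -
  obtain r K where K: "kraus_rep d n N r K" using channel_kraus[OF N] .
  have hx: "h g x < d" "h g' x < d" using h_less g x by auto
  have pc: "psi x \<in> carrier_vec (d * d)" using psi[OF x] by (simp add: unit_state_def)
  let ?P = "\<Prod>y\<in>X - {x}. reference_kernel d (psi y) (h g y) (h g' y)"
  have "received N n x $$ (b * E + g, b' * E + g') = (\<Sum>k<r. \<Sum>a<d. \<Sum>a'<d. K k b a *
      (psi x $ (a * d + h g x) * cnj (psi x $ (a' * d + h g' x)) * ?P) * cnj (K k b' a'))"
    unfolding received_def tensor_id_entry[OF K b g]
    by (intro sum.cong refl) (simp add: encoded_entry[OF x _ _ g])
  also have "\<dots> = (\<Sum>k<r. \<Sum>a<d. \<Sum>a'<d. K k b a *
      proj (psi x) $$ (a * d + h g x, a' * d + h g' x) * cnj (K k b' a')) * ?P"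
    unfolding sum_distrib_right
    by (intro sum.cong refl) (simp add: proj_entry[OF pc] mult_add_less hx mult_ac)
  also have "\<dots> = channel_output N d n (psi x) $$ (b * d + h g x, b' * d + h g' x) * ?P"
    unfolding channel_output_def tensor_id_entry[OF K b hx] ..
  finally show ?thesis .
qed

lemma received_carrier [simp]: "received N n x \<in> carrier_mat (n * E) (n * E)"
  by (simp add: received_def)

lemma received_psd: "x \<in> X \<Longrightarrow> channel d n N \<Longrightarrow> psd (n * E) (received N n x)"
  unfolding received_def by (intro tensor_id_psd discard_channel proj_psd shared_carrier)

lemma received_mtrace: "x \<in> X \<Longrightarrow> channel d n N \<Longrightarrow> mtrace (received N n x) = 1"
  unfolding received_def
  by (simp add: tensor_id_mtrace discard_channel proj_mtrace[OF shared_unit])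

lemma embed_index_eq: "a < d \<Longrightarrow> embed_index x r (b * d + a) = b * E + put x r a"
  by (simp add: embed_index_def)

text \<open>The registers that are traced out hold reference marginals, each of trace 1.\<close>

lemma reduced_received_same:
  assumes x: "x \<in> X" and N: "channel d n N"
  shows "reduced n x (received N n x) = channel_output N d n (psi x)"
proof (rule eq_matI)
  fix p q assume "p < dim_row (channel_output N d n (psi x))" "q < dim_col (channel_output N d n (psi x))"
  then have pq: "p < n * d" "q < n * d" by (auto simp: carrier_matD[OF channel_output_carrier])
  obtain b a where b: "b < n" "a < d" "p = b * d + a" by (rule mult_add_index[OF pq(1)])
  obtain b' a' where b': "b' < n" "a' < d" "q = b' * d + a'" by (rule mult_add_index[OF pq(2)])
  let ?W = "channel_output N d n (psi x) $$ (p, q)"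
  have "reduced n x (received N n x) $$ (p, q) =
    (\<Sum>r\<in>rest x. received N n x $$ (b * E + put x r a, b' * E + put x r a'))"
    using pq by (simp add: reduced_def b(3) b'(3) embed_index_eq[OF b(2)] embed_index_eq[OF b'(2)])
  also have "\<dots> = (\<Sum>r\<in>rest x. ?W * (\<Prod>y\<in>X - {x}. reference_kernel d (psi y) (r y) (r y)))"
    by (intro sum.cong refl)
      (simp add: received_entry[OF x N b(1) b'(1) put_less[OF x _ b(2)] put_less[OF x _ b'(2)]]
        h_put[OF x _ b(2)] h_put[OF x _ b'(2)] b(3) b'(3))
  also have "\<dots> = ?W * (\<Prod>y\<in>X - {x}. \<Sum>c<d. reference_kernel d (psi y) c c)"
    unfolding sum_distrib_left[symmetric] sum_rest_prod[where f = "\<lambda>y c. reference_kernel d (psi y) c c"] ..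
  also have "(\<Prod>y\<in>X - {x}. \<Sum>c<d. reference_kernel d (psi y) c c) = 1"
    by (intro prod.neutral ballI reference_kernel_trace psi) auto
  finally show "reduced n x (received N n x) $$ (p, q) = ?W" by simp
qed (auto simp: reduced_def carrier_matD[OF channel_output_carrier])

text \<open>Register \<open>x\<close> now holds an untouched reference marginal, and tracing out
  register \<open>y\<close> turns the channel output into its marginal. The remaining registers
  contribute traces equal to 1.\<close>

lemma reduced_received_other:
  assumes x: "x \<in> X" and y: "y \<in> X" and ne: "x \<noteq> y" and N: "channel d n N"
  shows "reduced n x (received N n y) = kron (output_marginal N d n (psi y)) (reference_marginal d (psi x))"
proof (rule eq_matI)
  fix p q assume "p < dim_row (kron (output_marginal N d n (psi y)) (reference_marginal d (psi x)))"
    "q < dim_col (kron (output_marginal N d n (psi y)) (reference_marginal d (psi x)))"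
  then have pq: "p < n * d" "q < n * d" by (auto simp: kron_def output_marginal_def reference_marginal_def)
  obtain b a where b: "b < n" "a < d" "p = b * d + a" by (rule mult_add_index[OF pq(1)])
  obtain b' a' where b': "b' < n" "a' < d" "q = b' * d + a'" by (rule mult_add_index[OF pq(2)])
  \<comment> \<open>\<open>F\<close> treats the channel output as the factor belonging to register
    \<open>y\<close>, so that the partial trace over all registers but \<open>x\<close> is again a
    sum of products.\<close>
  define F where "F z c = (if z = y then channel_output N d n (psi y) $$ (b * d + c, b' * d + c)
    else reference_kernel d (psi z) c c)" for z c
  have yX: "y \<in> X - {x}" and xX: "x \<in> X - {y}" and XX: "X - {y} - {x} = X - {x} - {y}" using x y ne by auto
  have fin: "finite (X - {x})" "finite (X - {y})" using finite_X by auto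
  have "reduced n x (received N n y) $$ (p, q) =
    (\<Sum>r\<in>rest x. received N n y $$ (b * E + put x r a, b' * E + put x r a'))"
    using pq by (simp add: reduced_def b(3) b'(3) embed_index_eq[OF b(2)] embed_index_eq[OF b'(2)])
  also have "\<dots> = (\<Sum>r\<in>rest x. reference_kernel d (psi x) a a' * (\<Prod>z\<in>X - {x}. F z (r z)))"
  proof (rule sum.cong[OF refl])
    fix r assume r: "r \<in> rest x"
    note hp = h_put[OF x r b(2)] h_put[OF x r b'(2)]
    have "(\<Prod>z\<in>X - {y}. reference_kernel d (psi z) (h (put x r a) z) (h (put x r a') z)) =
      reference_kernel d (psi x) a a' * (\<Prod>z\<in>X - {x} - {y}. reference_kernel d (psi z) (r z) (r z))"
      unfolding prod.remove[OF fin(2) xX] XX hp by (simp cong: prod.cong_simp)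
    moreover have "(\<Prod>z\<in>X - {x}. F z (r z)) = channel_output N d n (psi y) $$ (b * d + r y, b' * d + r y) *
      (\<Prod>z\<in>X - {x} - {y}. reference_kernel d (psi z) (r z) (r z))"
      unfolding prod.remove[OF fin(1) yX] by (simp add: F_def)
    ultimately show "received N n y $$ (b * E + put x r a, b' * E + put x r a') =
      reference_kernel d (psi x) a a' * (\<Prod>z\<in>X - {x}. F z (r z))"
      unfolding received_entry[OF y N b(1) b'(1) put_less[OF x r b(2)] put_less[OF x r b'(2)]]
      using ne by (simp add: hp)
  qed
  also have "\<dots> = reference_kernel d (psi x) a a' * (\<Prod>z\<in>X - {x}. \<Sum>c<d. F z c)"
    unfolding sum_distrib_left[symmetric] sum_rest_prod ..
  also have "(\<Prod>z\<in>X - {x}. \<Sum>c<d. F z c) = (\<Sum>c<d. F y c) * (\<Prod>z\<in>X - {x} - {y}. \<Sum>c<d. F z c)"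
    by (rule prod.remove[OF fin(1) yX])
  also have "(\<Prod>z\<in>X - {x} - {y}. \<Sum>c<d. F z c) = 1"
    by (intro prod.neutral ballI) (simp add: F_def reference_kernel_trace psi)
  also have "(\<Sum>c<d. F y c) = output_marginal N d n (psi y) $$ (b, b')"
    using b b' by (simp add: F_def output_marginal_def)
  finally show "reduced n x (received N n y) $$ (p, q) =
      kron (output_marginal N d n (psi y)) (reference_marginal d (psi x)) $$ (p, q)"
    using pq b b' by (simp add: kron_def output_marginal_def reference_marginal_def)
qed (auto simp: reduced_def kron_def output_marginal_def reference_marginal_def)

end


section \<open>The averaged output state and the coding theorem\<close>

lemma average_density:
  assumes "finite I" "I \<noteq> {}" "\<And>j. j \<in> I \<Longrightarrow> density n (f j)"
  shows "density n (complex_of_real (1 / real (card I)) \<cdot>\<^sub>m set_msum n f I)"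
proof -
  have "mtrace (set_msum n f I) = of_nat (card I)"
    using assms(3) by (subst mtrace_set_msum) (auto simp: density_def psd_carrier)
  then have "mtrace (complex_of_real (1 / real (card I)) \<cdot>\<^sub>m set_msum n f I) = 1"
    using assms(1,2) by (simp add: mtrace_smult[OF set_msum_carrier])
  moreover have "psd n (complex_of_real (1 / real (card I)) \<cdot>\<^sub>m set_msum n f I)"
    using assms by (intro psd_smult psd_set_msum) (auto simp: density_def)
  ultimately show ?thesis by (simp add: density_def)
qed

lemma kron_carrier [simp]:
  "A \<in> carrier_mat n n \<Longrightarrow> B \<in> carrier_mat d d \<Longrightarrow> kron A B \<in> carrier_mat (n * d) (n * d)"
  by (auto simp: kron_def)

lemma kron_entry:
  assumes "A \<in> carrier_mat n n" "B \<in> carrier_mat d d" "p < n * d" "q < n * d"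
  shows "kron A B $$ (p, q) = A $$ (p div d, q div d) * B $$ (p mod d, q mod d)"
  using assms by (auto simp: kron_def)

text \<open>Linearity in the first factor; it turns the acceptance bound for the averaged output
  state into one for the sum over all channel indices.\<close>

lemma mtrace_kron_smult_set_msum:
  assumes f: "\<And>j. j \<in> I \<Longrightarrow> f j \<in> carrier_mat n n" and B: "B \<in> carrier_mat d d"
    and L: "L \<in> carrier_mat (n * d) (n * d)"
  shows "mtrace (L * kron (a \<cdot>\<^sub>m set_msum n f I) B) = a * (\<Sum>j\<in>I. mtrace (L * kron (f j) B))"
proof -
  have "kron (a \<cdot>\<^sub>m set_msum n f I) B = a \<cdot>\<^sub>m set_msum (n * d) (\<lambda>j. kron (f j) B) I"
  proof (rule eq_matI)
    fix p q assume "p < dim_row (a \<cdot>\<^sub>m set_msum (n * d) (\<lambda>j. kron (f j) B) I)"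
      "q < dim_col (a \<cdot>\<^sub>m set_msum (n * d) (\<lambda>j. kron (f j) B) I)"
    then have pq: "p < n * d" "q < n * d" by (auto simp: set_msum_def)
    then have "p div d < n" "q div d < n" by (auto simp: less_mult_imp_div_less)
    then show "kron (a \<cdot>\<^sub>m set_msum n f I) B $$ (p, q) = (a \<cdot>\<^sub>m set_msum (n * d) (\<lambda>j. kron (f j) B) I) $$ (p, q)"
      unfolding kron_entry[OF smult_carrier_mat[OF set_msum_carrier] B pq] using pq
      by (simp add: set_msum_def kron_entry[OF f B pq] sum_distrib_right mult.assoc)
  qed (use B in \<open>auto simp: kron_def set_msum_def\<close>)
  then have "mtrace (L * kron (a \<cdot>\<^sub>m set_msum n f I) B) = a * mtrace (L * set_msum (n * d) (\<lambda>j. kron (f j) B) I)"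
    using L by (simp add: mult_smult_distrib[OF L set_msum_carrier] mtrace_smult[OF mult_carrier_mat[OF L set_msum_carrier]])
  also have "L * set_msum (n * d) (\<lambda>j. kron (f j) B) I = set_msum (n * d) (\<lambda>j. L * kron (f j) B) I"
    by (rule set_msum_mult_left[OF _ L]) (use f B in auto)
  also have "mtrace \<dots> = (\<Sum>j\<in>I. mtrace (L * kron (f j) B))"
    by (rule mtrace_set_msum) (use f B L in \<open>auto intro!: mult_carrier_mat[of _ "n * d" "n * d"]\<close>)
  finally show ?thesis .
qed

lemma neglog2_greater_imp:
  assumes "ereal t < neglog2 x"
  shows "x < 2 powr (- t)"
proof (cases "x \<le> 0")
  \<comment> \<open>Here \<open>neglog2\<close> is infinite and the bound holds because the power is
    positive.\<close>
  case True
  then show ?thesis by (smt (verit) powr_gt_zero)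
next
  case False
  then have "log 2 x < - t" using assms by (simp add: neglog2_def)
  then show ?thesis using False by (simp add: log_less_iff)
qed

text \<open>The left side of \<open>err\<close> adds the rejection probability of the right
  position, the acceptance probabilities over the full grid of \<open>s * M\<close> positions, and
  the slack of the measurement. It is demanded for at least two messages only, since a decoder with
  a single outcome never errs.\<close>

theorem position_based_code:
  fixes s M dA dB :: nat and N :: "nat \<Rightarrow> complex mat \<Rightarrow> complex mat" and phi :: "nat \<Rightarrow> complex vec"
  assumes s: "1 \<le> s" and M: "1 \<le> M" and dA: "0 < dA"
    and N: "\<And>i. i \<in> {1..s} \<Longrightarrow> channel dA dB (N i)"
    and phi: "\<And>i. i \<in> {1..s} \<Longrightarrow> unit_state (dA * dA) (phi i)"
    and lam: "\<And>i. i \<in> {1..s} \<Longrightarrow> effect (dB * dA) (lam i)"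
    and del: "0 < del"
    and err: "\<And>i. 1 < M \<Longrightarrow> i \<in> {1..s} \<Longrightarrow>
      1 - Re (mtrace (lam i * channel_output (N i) dA dB (phi i)))
      + real M * (\<Sum>j\<in>{1..s}. Re (mtrace (lam i * kron (output_marginal (N j) dA dB (phi j)) (reference_marginal dA (phi i)))))
      + del \<le> eps"
    and eps: "0 \<le> eps"
  shows "\<exists>(dEA::nat) (dEB::nat) (\<theta>::complex vec)
       (Enc :: nat \<Rightarrow> nat \<Rightarrow> complex mat \<Rightarrow> complex mat) (D :: nat \<Rightarrow> complex mat).
       0 < dEA \<and> 0 < dEB \<and> unit_state (dEA * dEB) \<theta> \<and>
       (\<forall>i \<in> {1..s}. \<forall>m < M. channel dEA dA (Enc i m)) \<and>
       (\<forall>m' < M. psd (dB * dEB) (D m')) \<and>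
       msum (dB * dEB) D [0..<M] = 1\<^sub>m (dB * dEB) \<and>
       (\<forall>i \<in> {1..s}. \<forall>m < M.
          1 - Re (mtrace (D m * tensor_id (N i) dA dB dEB
                                   (tensor_id (Enc i m) dEA dA dEB (proj \<theta>)))) \<le> eps)"
proof -
  define X where "X = {1..s} \<times> {..<M}"
  have finX: "finite X" by (simp add: X_def)
  define E where "E = card (X \<rightarrow>\<^sub>E {..<dA})"
  have "finite (X \<rightarrow>\<^sub>E {..<dA})" using finX by (intro finite_PiE) auto
  then obtain h where "bij_betw h {..<E} (X \<rightarrow>\<^sub>E {..<dA})"
    using ex_bij_betw_nat_finite[of "X \<rightarrow>\<^sub>E {..<dA}"] by (auto simp: E_def atLeast0LessThan)
  then interpret position_coding X dA E h "\<lambda>x. phi (fst x)"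
    by unfold_locales (use finX dA phi in \<open>auto simp: X_def\<close>)
  define W where "W x = received (N (fst x)) dB x" for x
  define n where "n = dB * E"
  have Nx: "channel dA dB (N (fst x))" if "x \<in> X" for x using N that by (auto simp: X_def)
  have W: "psd n (W x)" "mtrace (W x) = 1" if "x \<in> X" for x
    using received_psd[OF that Nx[OF that]] received_mtrace[OF that Nx[OF that]] by (auto simp: W_def n_def)
  have Wc: "W x \<in> carrier_mat n n" for x by (simp add: W_def n_def)
  have ne: "X \<noteq> {}" using s M by (auto simp: X_def lessThan_empty_iff)
  obtain D where D: "\<And>x. x \<in> X \<Longrightarrow> psd n (D x)" "set_msum n D X = 1\<^sub>m n"
    and le: "\<And>x T. x \<in> X \<Longrightarrow> effect n T \<Longrightarrow>
      2 * Re (mtrace (W x * T)) \<le> Re (mtrace (W x * D x)) + (\<Sum>y\<in>X. Re (mtrace (W y * T))) + del"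
    using pretty_good_measurement[where X = X and n = n and W = W, OF finX ne W(1) del] by blast
  \<comment> \<open>Bob has to name the message but not the channel, so the outcomes with the same
    message are merged.\<close>
  define D' where "D' m = set_msum n (\<lambda>i. D (i, m)) {1..s}" for m
  have Dc: "D (i, m) \<in> carrier_mat n n" if "i \<in> {1..s}" "m < M" for i m
    using D(1)[of "(i, m)"] that by (auto simp: X_def intro!: psd_carrier)
  have D'psd: "psd n (D' m)" if "m < M" for m
    unfolding D'_def using D(1) that by (intro psd_set_msum) (auto simp: X_def)
  have D'sum: "msum n D' [0..<M] = 1\<^sub>m n"
  proof -
    have "msum n D' [0..<M] = set_msum n D' {..<M}"
      by (subst msum_eq_set_msum) (auto simp: D'_def atLeast0LessThan)
    also have "\<dots> = set_msum n D X"
    proof (rule eq_matI)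
      fix p q assume "p < dim_row (set_msum n D X)" "q < dim_col (set_msum n D X)"
      then have pq: "p < n" "q < n" by (auto simp: set_msum_def)
      have "set_msum n D' {..<M} $$ (p, q) = (\<Sum>m<M. \<Sum>i\<in>{1..s}. D (i, m) $$ (p, q))"
        using pq by (simp add: set_msum_def D'_def)
      also have "\<dots> = (\<Sum>i\<in>{1..s}. \<Sum>m<M. D (i, m) $$ (p, q))" by (rule sum.swap)
      also have "\<dots> = set_msum n D X $$ (p, q)"
        using pq by (simp add: set_msum_def X_def sum.cartesian_product case_prod_unfold)
      finally show "set_msum n D' {..<M} $$ (p, q) = set_msum n D X $$ (p, q)" .
    qed (auto simp: set_msum_def)
    finally show ?thesis using D(2) by simp
  qed
  have error: "1 - Re (mtrace (D' m * W (i, m))) \<le> eps" if i: "i \<in> {1..s}" and m: "m < M" for i m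
  proof (cases "M = 1")
    case True
    have "D' m = 1\<^sub>m n" using D'sum D'psd[of 0] m True psd_carrier[of n "D' 0"] by (simp add: msum_def)
    then have "mtrace (D' m * W (i, m)) = 1"
      using W(2)[of "(i, m)"] i m left_mult_one_mat[OF Wc] by (simp add: X_def)
    then show ?thesis using eps by simp
  next
    case False
    then have M2: "1 < M" using M by simp
    let ?x = "(i, m)"
    have x: "?x \<in> X" using i m by (simp add: X_def)
    define T where "T = lift_op dB ?x (lam i)"
    have T: "effect n T" unfolding T_def n_def by (rule lift_op_effect[OF x lam[OF i]])
    have Tc: "T \<in> carrier_mat n n" and lc: "lam i \<in> carrier_mat (dB * dA) (dB * dA)"
      using T lam[OF i] by (auto simp: effect_def psd_carrier)
    have comm: "mtrace (W y * T) = mtrace (T * W y)" for y by (rule mtrace_comm[OF Wc Tc])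
    define q where "q j = Re (mtrace (lam i * kron (output_marginal (N j) dA dB (phi j)) (reference_marginal dA (phi i))))" for j
    have same: "Re (mtrace (W ?x * T)) = Re (mtrace (lam i * channel_output (N i) dA dB (phi i)))"
      unfolding comm unfolding T_def W_def
      using mtrace_lift_op[OF x lc received_carrier] reduced_received_same[OF x Nx[OF x]] by simp
    have other: "Re (mtrace (W y * T)) = q (fst y)" if "y \<in> X" "y \<noteq> ?x" for y
      unfolding comm unfolding T_def W_def q_def
      using mtrace_lift_op[OF x lc received_carrier] reduced_received_other[OF x that(1) _ Nx[OF that(1)]] that(2) by simp
    \<comment> \<open>A second message exists, so the position of \<open>m'\<close> with the same
      channel index exhibits \<open>q i\<close> as the trace of a product of positive matrices,
      hence as nonnegative.\<close>
    define m' where "m' = (if m = 0 then 1 else 0 :: nat)"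
    have m': "(i, m') \<in> X" "(i, m') \<noteq> ?x" using i M2 by (auto simp: m'_def X_def)
    have "0 \<le> q i"
      using other[OF m'] psd_mtrace_mult[OF W(1)[OF m'(1)], of T] T by (simp add: effect_def)
    have "(\<Sum>y\<in>X. Re (mtrace (W y * T))) = Re (mtrace (W ?x * T)) + (\<Sum>y\<in>X - {?x}. Re (mtrace (W y * T)))"
      by (rule sum.remove[OF finX x])
    also have "(\<Sum>y\<in>X - {?x}. Re (mtrace (W y * T))) = (\<Sum>y\<in>X - {?x}. q (fst y))"
      by (intro sum.cong refl other) auto
    \<comment> \<open>Completing the wrong positions to the full grid adds the term
      \<open>q i\<close>, which does not depend on the message.\<close>
    also have "\<dots> = (\<Sum>y\<in>X. q (fst y)) - q i"
      using sum.remove[OF finX x, of "\<lambda>y. q (fst y)"] by simp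
    also have "(\<Sum>y\<in>X. q (fst y)) = (\<Sum>j\<in>{1..s}. \<Sum>k<M. q j)"
      unfolding X_def sum.cartesian_product by (simp add: case_prod_unfold)
    also have "\<dots> = real M * (\<Sum>j\<in>{1..s}. q j)" by (simp add: sum_distrib_left)
    finally have tot: "(\<Sum>y\<in>X. Re (mtrace (W y * T))) = Re (mtrace (W ?x * T)) + (real M * (\<Sum>j\<in>{1..s}. q j) - q i)" .
    \<comment> \<open>The right message with a wrong channel index still counts as success, so the
      exact outcome gives a lower bound.\<close>
    have DxW: "Re (mtrace (W ?x * D ?x)) \<le> Re (mtrace (D' m * W ?x))"
    proof -
      have "Re (mtrace (W ?x * D ?x)) = Re (mtrace (D (i, m) * W ?x))"
        using mtrace_comm[OF Wc Dc[OF i m]] by simp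
      also have "\<dots> \<le> (\<Sum>j\<in>{1..s}. Re (mtrace (D (j, m) * W ?x)))"
        by (rule member_le_sum[OF i]) (use D(1) W(1)[OF x] m in \<open>auto intro!: psd_mtrace_mult simp: X_def\<close>)
      also have "\<dots> = Re (mtrace (D' m * W ?x))"
        unfolding D'_def using Dc m Wc
        by (subst set_msum_mult_right, simp, simp, subst mtrace_set_msum)
          (auto intro!: mult_carrier_mat[of _ n n _ n])
      finally show ?thesis .
    qed
    have "2 * Re (mtrace (W ?x * T)) \<le> Re (mtrace (W ?x * D ?x)) + (\<Sum>y\<in>X. Re (mtrace (W y * T))) + del"
      by (rule le[OF x T])
    \<comment> \<open>The acceptance at the right position occurs twice on the left and once in the
      total, so one copy survives; the nonnegative \<open>q i\<close> is dropped.\<close>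
    then have "1 - Re (mtrace (D' m * W ?x)) \<le> 1 - Re (mtrace (W ?x * T)) + real M * (\<Sum>j\<in>{1..s}. q j) + del"
      using DxW \<open>0 \<le> q i\<close> unfolding tot by linarith
    then show ?thesis using err[OF M2 i] unfolding same q_def by linarith
  qed
  have mem: "(i, m) \<in> X" if "i \<in> {1..s}" "m < M" for i m using that by (simp add: X_def)
  show ?thesis
  proof (intro exI conjI)
    show "0 < E" "0 < E" by (rule E_pos)+
    show "unit_state (E * E) shared" by (rule shared_unit)
    show "\<forall>i\<in>{1..s}. \<forall>m<M. channel E dA (discard (i, m))" using discard_channel mem by blast
    show "\<forall>m'<M. psd (dB * E) (D' m')" using D'psd by (simp add: n_def)
    show "msum (dB * E) D' [0..<M] = 1\<^sub>m (dB * E)" using D'sum by (simp add: n_def)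
    show "\<forall>i\<in>{1..s}. \<forall>m<M. 1 - Re (mtrace (D' m * tensor_id (N i) dA dB E
        (tensor_id (discard (i, m)) E dA E (proj shared)))) \<le> eps"
      using error by (simp add: W_def received_def)
  qed
qed


theorem theorem3:
  fixes s dA dB :: nat
    and N :: "nat \<Rightarrow> complex mat \<Rightarrow> complex mat"
    and eps eta R :: real
  assumes "1 \<le> s" and "0 < dA" and "0 < dB"
    and "\<forall>i \<in> {1..s}. channel dA dB (N i)"
    and "0 < eps" and "eps < 1" and "0 < eta" and "eta < 1"
    and "ereal R \<le> (INF i \<in> {1..s}.
           (SUP \<psi> \<in> {\<psi>. unit_state (dA * dA) \<psi>}. IH eps dB dA (tensor_id (N i) dA dB dA (proj \<psi>)))
           + ereal (log 2 (2 * real s) * log 2 (eta / (6 * log 2 (2 * real s)))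
                    + log 2 (eps / (4 * (real s)\<^sup>2))))"
  shows "EA_code_informed s dA dB N R (eps + 3 * eta)"
proof -
  let ?c = "log 2 (2 * real s) * log 2 (eta / (6 * log 2 (2 * real s))) + log 2 (eps / (4 * (real s)\<^sup>2))"
  note s = assms(1) and dA = assms(2) and N = assms(4) and eps = assms(5,6) and eta = assms(7,8)
  define M where "M = nat \<lceil>2 powr R\<rceil>"
  have M1: "1 \<le> M" unfolding M_def by (simp add: Suc_le_eq)
  have "\<exists>phi lam. (\<forall>i\<in>{1..s}. unit_state (dA * dA) (phi i)) \<and> (\<forall>i\<in>{1..s}. effect (dB * dA) (lam i)) \<and>
    (1 < M \<longrightarrow> (\<forall>i\<in>{1..s}. 1 - Re (mtrace (lam i * channel_output (N i) dA dB (phi i)))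
      + real M * (\<Sum>j\<in>{1..s}. Re (mtrace (lam i * kron (output_marginal (N j) dA dB (phi j)) (reference_marginal dA (phi i)))))
      + eta \<le> eps + 3 * eta))"
  proof (cases "1 < M")
    case False
    \<comment> \<open>With one message the error condition is void and any states and tests will
      do.\<close>
    have "unit_state (dA * dA) (unit_vec (dA * dA) 0)"
      using dA by (simp add: unit_state_def unit_vec_def if_distrib[of cmod] if_distrib[of "\<lambda>x. x\<^sup>2"] cong: if_cong)
    moreover have "effect (dB * dA) (1\<^sub>m (dB * dA))"
      using psd_one[of "dB * dA"] psd_zero[of "dB * dA"]
      by (simp add: effect_def minus_r_inv_mat[OF one_carrier_mat])
    ultimately show ?thesis
      using False by (intro exI[of _ "\<lambda>_. unit_vec (dA * dA) 0"] exI[of _ "\<lambda>_. 1\<^sub>m (dB * dA)"]) simp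
  next
    case True
    have R: "0 < R"
    proof (rule ccontr)
      assume "\<not> 0 < R"
      then have "2 powr R \<le> 1" using powr_mono[of R 0 "2 :: real"] by simp
      then have "\<lceil>2 powr R\<rceil> \<le> 1" by (simp add: ceiling_le_iff)
      then show False using True by (simp add: M_def)
    qed
    \<comment> \<open>Rounding up adds less than 1, which is at most \<open>2 powr R\<close> because
      \<open>R\<close> is positive.\<close>
    have M2: "real M \<le> 2 * 2 powr R"
    proof -
      have "1 \<le> 2 powr R" using R powr_mono[of 0 R "2 :: real"] by simp
      moreover have "real M \<le> 2 powr R + 1" unfolding M_def by (simp add: of_nat_nat)
      ultimately show ?thesis by linarith
    qed
    \<comment> \<open>One bit is given up to make the inequality strict, so that suprema that may
      not be attained still yield an actual state here and an actual test later.\<close>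
    have "\<forall>i\<in>{1..s}. \<exists>p. unit_state (dA * dA) p \<and> ereal (R - ?c - 1) < IH eps dB dA (channel_output (N i) dA dB p)"
    proof
      fix i assume i: "i \<in> {1..s}"
      let ?S = "SUP \<psi> \<in> {\<psi>. unit_state (dA * dA) \<psi>}. IH eps dB dA (tensor_id (N i) dA dB dA (proj \<psi>))"
      have "ereal R \<le> ?S + ereal ?c" using assms(9) INF_lower[OF i] by (rule order_trans)
      then have "ereal (R - ?c - 1) < ?S" by (cases ?S) auto
      then show "\<exists>p. unit_state (dA * dA) p \<and> ereal (R - ?c - 1) < IH eps dB dA (channel_output (N i) dA dB p)"
        by (auto simp: less_SUP_iff channel_output_def)
    qed
    then obtain phi where phi: "\<And>i. i \<in> {1..s} \<Longrightarrow> unit_state (dA * dA) (phi i)"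
      and IH: "\<And>i. i \<in> {1..s} \<Longrightarrow> ereal (R - ?c - 1) < IH eps dB dA (channel_output (N i) dA dB (phi i))"
      by (metis (no_types, lifting) bchoice)
    define \<sigma> where "\<sigma> i = reference_marginal dA (phi i)" for i
    define om where "om j = output_marginal (N j) dA dB (phi j)" for j
    \<comment> \<open>The test for channel \<open>i\<close> must reject the outputs of every channel
      \<open>j\<close> at a wrong position. A single averaged state covers them all at the cost of a
      factor \<open>s\<close>.\<close>
    define \<tau> where "\<tau> = complex_of_real (1 / real (card {1..s})) \<cdot>\<^sub>m set_msum dB om {1..s}"
    have om: "density dB (om j)" if "j \<in> {1..s}" for j
      unfolding om_def using phi[OF that] N that by (intro output_marginal_density) auto
    have \<tau>: "density dB \<tau>" unfolding \<tau>_def using s by (intro average_density om) auto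
    have \<sigma>: "density dA (\<sigma> i)" if "i \<in> {1..s}" for i
      unfolding \<sigma>_def by (rule reference_marginal_density[OF phi[OF that]])
    have "\<forall>i\<in>{1..s}. \<exists>L. effect (dB * dA) L \<and> 1 - eps \<le> Re (mtrace (L * channel_output (N i) dA dB (phi i))) \<and>
      Re (mtrace (L * kron \<tau> (\<sigma> i))) < 2 powr (- (R - ?c - 1))"
    proof
      fix i assume i: "i \<in> {1..s}"
      \<comment> \<open>The infimum over product states is bounded by its value at the marginals
        that occur at wrong positions.\<close>
      have "IH eps dB dA (channel_output (N i) dA dB (phi i)) \<le>
        DH eps (dB * dA) (channel_output (N i) dA dB (phi i)) (kron \<tau> (\<sigma> i))"
        unfolding IH_def using \<tau> \<sigma>[OF i] by (intro Inf_lower) blast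
      with IH[OF i] have "ereal (R - ?c - 1) < DH eps (dB * dA) (channel_output (N i) dA dB (phi i)) (kron \<tau> (\<sigma> i))"
        by (rule less_le_trans)
      then obtain L where "effect (dB * dA) L" "1 - eps \<le> Re (mtrace (L * channel_output (N i) dA dB (phi i)))"
        "ereal (R - ?c - 1) < neglog2 (Re (mtrace (L * kron \<tau> (\<sigma> i))))"
        unfolding DH_def less_Sup_iff by blast
      then show "\<exists>L. effect (dB * dA) L \<and> 1 - eps \<le> Re (mtrace (L * channel_output (N i) dA dB (phi i))) \<and>
          Re (mtrace (L * kron \<tau> (\<sigma> i))) < 2 powr (- (R - ?c - 1))"
        using neglog2_greater_imp by blast
    qed
    then obtain lam where lam: "\<And>i. i \<in> {1..s} \<Longrightarrow> effect (dB * dA) (lam i)"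
      and lam1: "\<And>i. i \<in> {1..s} \<Longrightarrow> 1 - eps \<le> Re (mtrace (lam i * channel_output (N i) dA dB (phi i)))"
      and lam2: "\<And>i. i \<in> {1..s} \<Longrightarrow> Re (mtrace (lam i * kron \<tau> (\<sigma> i))) < 2 powr (- (R - ?c - 1))"
      by (metis (no_types, lifting) bchoice)
    have c: "2 powr ?c \<le> eta * eps / (24 * real s)"
    proof -
      define L where "L = log 2 (2 * real s)"
      have L: "1 \<le> L" using s by (simp add: L_def le_log_iff)
      have e6: "0 < eta / (6 * L)" "eta / (6 * L) \<le> eta / 6" using L eta by (auto simp: field_simps)
      have "2 powr ?c = (eta / (6 * L)) powr L * (eps / (4 * (real s)\<^sup>2))"
        unfolding L_def[symmetric] powr_add using e6 eps s by (simp add: mult.commute[of L] flip: powr_powr)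
      also have "\<dots> \<le> eta / 6 * (eps / (4 * (real s)\<^sup>2))"
      proof (rule mult_right_mono)
        \<comment> \<open>The base lies below 1 and \<open>L\<close> is at least 1, so the power is
          at most its base.\<close>
        have "(eta / (6 * L)) powr L \<le> eta / (6 * L)"
          using e6 L eta by (intro powr_le_one_le) auto
        then show "(eta / (6 * L)) powr L \<le> eta / 6" using e6(2) by (rule order_trans)
      qed (use eps in simp)
      \<comment> \<open>One of the two factors \<open>s\<close> in the denominator suffices; it
        cancels the \<open>s\<close> lost by averaging.\<close>
      also have "\<dots> \<le> eta * eps / (24 * real s)"
        using eta eps s by (simp add: field_simps power2_eq_square)
      finally show ?thesis .
    qed
    have "1 - Re (mtrace (lam i * channel_output (N i) dA dB (phi i)))
      + real M * (\<Sum>j\<in>{1..s}. Re (mtrace (lam i * kron (om j) (\<sigma> i)))) + eta \<le> eps + 3 * eta"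
      if i: "i \<in> {1..s}" for i
    proof -
      have "mtrace (lam i * kron \<tau> (\<sigma> i)) = complex_of_real (1 / real (card {1..s})) * (\<Sum>j\<in>{1..s}. mtrace (lam i * kron (om j) (\<sigma> i)))"
        unfolding \<tau>_def
        by (rule mtrace_kron_smult_set_msum[where d = dA])
          (use om \<sigma>[OF i] lam[OF i] in \<open>auto simp: density_def effect_def psd_carrier\<close>)
      then have "(\<Sum>j\<in>{1..s}. Re (mtrace (lam i * kron (om j) (\<sigma> i)))) = real s * Re (mtrace (lam i * kron \<tau> (\<sigma> i)))"
        using s by simp
      also have "\<dots> \<le> real s * 2 powr (- (R - ?c - 1))"
        using lam2[OF i] by (intro mult_left_mono) auto
      finally have "real M * (\<Sum>j\<in>{1..s}. Re (mtrace (lam i * kron (om j) (\<sigma> i)))) \<le> real M * (real s * 2 powr (- (R - ?c - 1)))"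
        by (intro mult_left_mono) auto
      also have "\<dots> \<le> 2 * 2 powr R * (real s * 2 powr (- (R - ?c - 1)))"
        using M2 by (intro mult_right_mono) auto
      \<comment> \<open>The factor 4 collects the 2 from rounding up the number of messages and the
        2 from the bit given up.\<close>
      also have "\<dots> = 4 * real s * 2 powr ?c"
      proof -
        have "2 * 2 powr R * (real s * 2 powr (- (R - t - 1))) = 4 * real s * 2 powr t" for t :: real
        proof -
          have "2 powr (- (R - t - 1)) = 2 powr (- R + t + 1)" by (rule arg_cong) simp
          also have "\<dots> = 2 powr (- R) * 2 powr t * 2" by (simp only: powr_add) simp
          finally show ?thesis by (simp add: powr_minus)
        qed
        then show ?thesis .
      qed
      also have "\<dots> \<le> 4 * real s * (eta * eps / (24 * real s))" using c by (intro mult_left_mono) auto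
      also have "\<dots> \<le> eta"
      proof -
        have "4 * real s * (eta * eps / (24 * real s)) = eta * eps / 6" using s by simp
        moreover have "eta * eps \<le> eta * 1" using eta eps by (intro mult_left_mono) auto
        ultimately show ?thesis using eta by simp
      qed
      \<comment> \<open>The rejection probability is at most \<open>eps\<close>; the wrong positions
        and the measurement slack cost at most \<open>eta\<close> each, within the allowance of
        \<open>3 * eta\<close>.\<close>
      finally show ?thesis using lam1[OF i] eta by linarith
    qed
    then show ?thesis
      using phi lam unfolding om_def \<sigma>_def
      by (intro exI[of _ phi] exI[of _ lam] conjI ballI impI) simp_all
  qed
  then obtain phi lam where phi: "\<And>i. i \<in> {1..s} \<Longrightarrow> unit_state (dA * dA) (phi i)"
    and lam: "\<And>i. i \<in> {1..s} \<Longrightarrow> effect (dB * dA) (lam i)"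
    and err: "\<And>i. 1 < M \<Longrightarrow> i \<in> {1..s} \<Longrightarrow> 1 - Re (mtrace (lam i * channel_output (N i) dA dB (phi i)))
      + real M * (\<Sum>j\<in>{1..s}. Re (mtrace (lam i * kron (output_marginal (N j) dA dB (phi j)) (reference_marginal dA (phi i)))))
      + eta \<le> eps + 3 * eta"
    by blast
  show ?thesis
    unfolding EA_code_informed_def Let_def M_def[symmetric]
    by (rule position_based_code[OF s M1 dA _ phi lam eta(1) err]) (use N eps eta in auto)
qed

end
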